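(* For every $C\in\mathbb{B}^{\ell\times m}$ and $D\in\mathbb{B}^{\ell\times n}$ there is a Presburger formula $\widetilde{\textsf{BiREG}}_{C,D}(\bar X,\bar Y)$ such that for all $\bar M\in\mathbb{N}^m$, $\bar N\in\mathbb{N}^n$ that are big enough with respect to $C,D$: there exists a $(C,D)$-biregular graph of size $(\bar M,\bar N)$ if and only if $\widetilde{\textsf{BiREG}}_{C,D}(\bar M,\bar N)$ holds.
   Context: A Presburger formula is a first-order formula with $+,\le,0,1$ interpreted over $\mathbb{N}$. $\mathbb{B}=\mathbb{N}\cup\{{\ge}d\mid d\in\mathbb{N}\}$, where "$x={\ge}d$" means $x\ge d$; $\lfloor{\ge}d\rfloor=d$, $\lfloor d\rfloor=d$, applied componentwise. Dot products of $\mathbb{B}$-vectors are computed after applying $\lfloor\cdot\rfloor$; $C\cdot\bar1=\sum_{i,j}\lfloor C_{i,j}\rfloor$; $\chi(\bar t)$ is the 0/1-vector with entry $0$ exactly where $\lfloor t_i\rfloor=0$. With rows $\bar c_i$ of $C$ and $\bar d_i$ of $D$, $\bar M=(M_1,\dots,M_m)$, $\bar N=(N_1,\dots,N_n)$ are big enough with respect to $C,D$ if for every $i\le\ell$: (1) $\bar M\cdot\chi(\bar c_i)+\bar N\cdot\chi(\bar d_i)\ge2(C\cdot\bar1)(D\cdot\bar1)+3$; (2) $\sum_{j:\,D_{i,j}\text{ of the form }{\ge}k}N_j\ge\max_{1\le j\le m}\lfloor C_{i,j}\rfloor$; (3) $\sum_{j:\,C_{i,j}\text{ of the form }{\ge}k}M_j\ge\max_{1\le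 j\le n}\lfloor D_{i,j}\rfloor$. An $\ell$-type bipartite graph is $G=(U,V,E_1,\dots,E_\ell)$ with pairwise disjoint $E_i\subseteq U\times V$; $\deg_{E_i}(u)$ is the number of $E_i$-edges at $u$. $G$ is $(C,D)$-biregular of size $(\bar M,\bar N)$ if there are partitions $U=U_1\cup\dots\cup U_m$, $V=V_1\cup\dots\cup V_n$ with $|U_j|=M_j$, $|V_j|=N_j$, $\deg_{E_i}(u)=C_{i,j}$ for $u\in U_j$ and $\deg_{E_i}(v)=D_{i,j}$ for $v\in V_j$. *)

theory Defs
  imports "Jordan_Normal_Form.Matrix"
begin

section \<open>Presburger formulas\<close>

datatype pterm = Var nat | Zero | One | Add pterm pterm

datatype pform =
    Eq pterm pterm
  | Le pterm pterm
  | Neg pform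
  | And pform pform
  | Or pform pform
  | Exists nat pform
  | Forall nat pform

primrec eval_pterm :: "(nat \<Rightarrow> nat) \<Rightarrow> pterm \<Rightarrow> nat" where
  "eval_pterm e (Var x) = e x"
| "eval_pterm e Zero = 0"
| "eval_pterm e One = 1"
| "eval_pterm e (Add s t) = eval_pterm e s + eval_pterm e t"

primrec sat :: "(nat \<Rightarrow> nat) \<Rightarrow> pform \<Rightarrow> bool" where
  "sat e (Eq s t) \<longleftrightarrow> eval_pterm e s = eval_pterm e t"
| "sat e (Le s t) \<longleftrightarrow> eval_pterm e s \<le> eval_pterm e t"
| "sat e (Neg \<phi>) \<longleftrightarrow> \<not> sat e \<phi>"
| "sat e (And \<phi> \<psi>) \<longleftrightarrow> sat e \<phi> \<and> sat e \<psi>"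
| "sat e (Or \<phi> \<psi>) \<longleftrightarrow> sat e \<phi> \<or> sat e \<psi>"
| "sat e (Exists x \<phi>) \<longleftrightarrow> (\<exists>a. sat (e(x := a)) \<phi>)"
| "sat e (Forall x \<phi>) \<longleftrightarrow> (\<forall>a. sat (e(x := a)) \<phi>)"

primrec vars_pterm :: "pterm \<Rightarrow> nat set" where
  "vars_pterm (Var x) = {x}"
| "vars_pterm Zero = {}"
| "vars_pterm One = {}"
| "vars_pterm (Add s t) = vars_pterm s \<union> vars_pterm t"

primrec free_vars :: "pform \<Rightarrow> nat set" where
  "free_vars (Eq s t) = vars_pterm s \<union> vars_pterm t"
| "free_vars (Le s t) = vars_pterm s \<union> vars_pterm t"
| "free_vars (Neg \<phi>) = free_vars \<phi>"
| "free_vars (And \<phi> \<psi>) = free_vars \<phi> \<union> free_vars \<psi>"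
| "free_vars (Or \<phi> \<psi>) = free_vars \<phi> \<union> free_vars \<psi>"
| "free_vars (Exists x \<phi>) = free_vars \<phi> - {x}"
| "free_vars (Forall x \<phi>) = free_vars \<phi> - {x}"

text \<open>
  A formula with free variables \<open>X\<^sub>1, \<dots>, X\<^sub>m, Y\<^sub>1, \<dots>, Y\<^sub>n\<close> is one whose free variables are among
  \<open>0, \<dots>, m + n - 1\<close>; the first \<open>m\<close> stand for the \<open>X\<^sub>j\<close>, the others for the \<open>Y\<^sub>j\<close>.
  The value 0 outside this range is irrelevant for such formulas.
\<close>

definition assignment :: "nat vec \<Rightarrow> nat vec \<Rightarrow> nat \<Rightarrow> nat" where
  "assignment M N k =
    (if k < dim_vec M + dim_vec N then (M @\<^sub>v N) $ k else 0)"

section \<open>Degree constraints\<close>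

datatype bnum = Exactly nat | is_AtLeast: AtLeast nat

primrec bfloor :: "bnum \<Rightarrow> nat" where
  "bfloor (Exactly d) = d"
| "bfloor (AtLeast d) = d"

primrec meets :: "nat \<Rightarrow> bnum \<Rightarrow> bool" where
  "meets x (Exactly d) \<longleftrightarrow> x = d"
| "meets x (AtLeast d) \<longleftrightarrow> x \<ge> d"

definition chi :: "bnum vec \<Rightarrow> nat vec" where
  "chi t = map_vec (\<lambda>b. if bfloor b = 0 then 0 else 1) t"

definition entry_sum :: "bnum mat \<Rightarrow> nat" where
  "entry_sum A = (\<Sum>i<dim_row A. \<Sum>j<dim_col A. bfloor (A $$ (i, j)))"

text \<open>Inserting 0 only fixes the maximum of an empty row to be 0.\<close>

definition row_max :: "bnum mat \<Rightarrow> nat \<Rightarrow> nat" where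
  "row_max A i = Max (insert 0 {bfloor (A $$ (i, j)) | j. j < dim_col A})"

definition big_enough :: "bnum mat \<Rightarrow> bnum mat \<Rightarrow> nat vec \<Rightarrow> nat vec \<Rightarrow> bool" where
  "big_enough C D M N \<longleftrightarrow> (\<forall>i < dim_row C.
     M \<bullet> chi (row C i) + N \<bullet> chi (row D i) \<ge> 2 * entry_sum C * entry_sum D + 3 \<and>
     (\<Sum>j | j < dim_col D \<and> is_AtLeast (D $$ (i, j)). N $ j) \<ge> row_max C i \<and>
     (\<Sum>j | j < dim_col C \<and> is_AtLeast (C $$ (i, j)). M $ j) \<ge> row_max D i)"

section \<open>Biregular graphs\<close>

definition bipartite_graph ::
    "nat \<Rightarrow> 'v set \<Rightarrow> 'v set \<Rightarrow> (nat \<Rightarrow> ('v \<times> 'v) set) \<Rightarrow> bool" where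
  "bipartite_graph l U V E \<longleftrightarrow>
     U \<inter> V = {} \<and>
     (\<forall>i<l. E i \<subseteq> U \<times> V) \<and>
     (\<forall>i<l. \<forall>i'<l. i \<noteq> i' \<longrightarrow> E i \<inter> E i' = {})"

definition deg :: "('v \<times> 'v) set \<Rightarrow> 'v \<Rightarrow> nat" where
  "deg F w = card {e \<in> F. fst e = w \<or> snd e = w}"

text \<open>
  Blocks may be empty. Finiteness is required explicitly because \<open>card\<close> is 0 on infinite sets.
\<close>

definition partition_of_size :: "'v set \<Rightarrow> nat vec \<Rightarrow> (nat \<Rightarrow> 'v set) \<Rightarrow> bool" where
  "partition_of_size W S P \<longleftrightarrow>
     W = (\<Union>j<dim_vec S. P j) \<and>
     (\<forall>j<dim_vec S. \<forall>j'<dim_vec S. j \<noteq> j' \<longrightarrow> P j \<inter> P j' = {}) \<and>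
     (\<forall>j<dim_vec S. finite (P j) \<and> card (P j) = S $ j)"

definition biregular ::
    "bnum mat \<Rightarrow> bnum mat \<Rightarrow> nat vec \<Rightarrow> nat vec \<Rightarrow>
     'v set \<Rightarrow> 'v set \<Rightarrow> (nat \<Rightarrow> ('v \<times> 'v) set) \<Rightarrow> bool" where
  "biregular C D M N U V E \<longleftrightarrow>
     bipartite_graph (dim_row C) U V E \<and>
     (\<exists>P Q. partition_of_size U M P \<and> partition_of_size V N Q \<and>
        (\<forall>i<dim_row C. \<forall>j<dim_vec M. \<forall>u\<in>P j. meets (deg (E i) u) (C $$ (i, j))) \<and>
        (\<forall>i<dim_row C. \<forall>j<dim_vec N. \<forall>v\<in>Q j. meets (deg (E i) v) (D $$ (i, j))))"

end

theory Submission
  imports Defs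
begin

text \<open>
  Among all biregular graphs on given finite sets of naturals, take one in which the sum of
  \<open>u + v + 1\<close> over all edges is minimal. An edge of type \<open>i\<close> between two vertices exceeding their bounds
  for \<open>i\<close> could be deleted, and an edge of type \<open>i\<close> at an exceeding vertex could be moved to a smaller
  one; counting the edges that must therefore be present bounds the number of exceeding vertices by a
  constant. All other vertices have exactly the prescribed degrees. So a graph is determined by
  boundedly many exceptional vertices, the numbers of other vertices with a given column and a
  given adjacency to the exceptional ones, and a graph of bounded exact degrees between the others.
  If an edge type occurs there only boundedly often, its end points are declared exceptional; if all
  types occur often or not at all, edge switching shows that equality of the degree sums on both
  sides suffices. These are linear conditions on the numbers of vertices.
\<close>

section \<open>Edge colourings\<close>

text \<open>
  An \<open>l\<close>-type bipartite graph is encoded as a function \<open>f u v \<le> l\<close>; the values below \<open>l\<close> are the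
  edge types, the value \<open>l\<close> means that there is no edge.
\<close>

definition cdeg :: "'b set \<Rightarrow> ('b \<Rightarrow> nat) \<Rightarrow> nat \<Rightarrow> nat" where
  "cdeg W g i = card {w \<in> W. g w = i}"

definition recolor :: "('a \<Rightarrow> 'b \<Rightarrow> nat) \<Rightarrow> 'a \<Rightarrow> 'b \<Rightarrow> nat \<Rightarrow> 'a \<Rightarrow> 'b \<Rightarrow> nat" where
  "recolor f u v k = f(u := (f u)(v := k))"

lemma cdeg_cong: "(\<And>w. w \<in> W \<Longrightarrow> g w = h w) \<Longrightarrow> cdeg W g i = cdeg W h i"
  unfolding cdeg_def by (rule arg_cong[where f = card]) auto

text \<open>The indicators stand on both sides so that no truncated subtraction occurs and the case
  \<open>g w = k\<close> is covered too.\<close>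

lemma cdeg_upd:
  assumes "finite W" "w \<in> W"
  shows "cdeg W (g(w := k)) i + of_bool (g w = i) = cdeg W g i + of_bool (k = i)"
proof -
  let ?S = "{x \<in> W - {w}. g x = i}"
  have fin: "finite ?S" using assms by simp
  have 1: "{x \<in> W. g x = i} = (if g w = i then insert w ?S else ?S)"
    using assms by auto
  have 2: "{x \<in> W. (g(w := k)) x = i} = (if k = i then insert w ?S else ?S)"
    using assms by auto
  show ?thesis unfolding cdeg_def 1 2 using fin by auto
qed

lemma row_recolor:
  assumes "finite V" "v \<in> V"
  shows "cdeg V (recolor f u v k x) i + of_bool (x = u \<and> f u v = i)
    = cdeg V (f x) i + of_bool (x = u \<and> k = i)"
  using cdeg_upd[OF assms, of "f u" k i] by (auto simp: recolor_def)

lemma col_recolor: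
  assumes "finite U" "u \<in> U"
  shows "cdeg U (\<lambda>x. recolor f u v k x y) i + of_bool (y = v \<and> f u v = i)
    = cdeg U (\<lambda>x. f x y) i + of_bool (y = v \<and> k = i)"
proof -
  have "(\<lambda>x. recolor f u v k x y) = (if y = v then (\<lambda>x. f x y)(u := k) else (\<lambda>x. f x y))"
    by (auto simp: recolor_def fun_eq_iff)
  then show ?thesis using cdeg_upd[OF assms, of "\<lambda>x. f x y" k i] by auto
qed

lemma cdeg_eq_sum: "finite W \<Longrightarrow> cdeg W g i = (\<Sum>w\<in>W. of_bool (g w = i))"
  unfolding cdeg_def by (simp add: of_bool_def sum.If_cases Int_def)

lemma cdeg_double_count:
  assumes "finite U" "finite V"
  shows "(\<Sum>u\<in>U. cdeg V (f u) i) = (\<Sum>v\<in>V. cdeg U (\<lambda>u. f u v) i)"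
  unfolding cdeg_eq_sum[OF assms(1)] cdeg_eq_sum[OF assms(2)] by (rule sum.swap)

lemma cdeg_pos_iff: "finite W \<Longrightarrow> cdeg W g i > 0 \<longleftrightarrow> (\<exists>w\<in>W. g w = i)"
  unfolding cdeg_def by (auto simp: card_gt_0_iff)

lemma card_colored_le:
  assumes "finite W" "\<And>i. i < l \<Longrightarrow> cdeg W g i \<le> B"
  shows "card {w \<in> W. g w < l} \<le> l * B"
proof -
  have "{w \<in> W. g w < l} = (\<Union>i<l. {w \<in> W. g w = i})" by auto
  then have "card {w \<in> W. g w < l} \<le> (\<Sum>i<l. cdeg W g i)"
    unfolding cdeg_def by (simp add: card_UN_le)
  also have "\<dots> \<le> (\<Sum>i<l. B)" using assms by (intro sum_mono) auto
  finally show ?thesis by simp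
qed

section \<open>Realising bounded exact degrees\<close>

definition bounded_by :: "nat \<Rightarrow> 'a set \<Rightarrow> 'b set \<Rightarrow> (nat \<Rightarrow> 'a \<Rightarrow> nat) \<Rightarrow> (nat \<Rightarrow> 'b \<Rightarrow> nat)
    \<Rightarrow> ('a \<Rightarrow> 'b \<Rightarrow> nat) \<Rightarrow> bool" where
  "bounded_by l U V a b f \<longleftrightarrow> (\<forall>u v. f u v \<le> l) \<and>
     (\<forall>i<l. \<forall>u\<in>U. cdeg V (f u) i \<le> a i u) \<and> (\<forall>i<l. \<forall>v\<in>V. cdeg U (\<lambda>u. f u v) i \<le> b i v)"

lemma bounded_by_add_edge:
  assumes "bounded_by l U V a b f" "finite U" "finite V" "u \<in> U" "v \<in> V" "i < l" "f u v = l"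
    "cdeg V (f u) i < a i u" "cdeg U (\<lambda>x. f x v) i < b i v"
  shows "bounded_by l U V a b (recolor f u v i)"
proof -
  have "cdeg V (recolor f u v i x) j \<le> a j x" if "x \<in> U" "j < l" for x j
    using row_recolor[of V v f u i x j] assms that
    by (auto simp: bounded_by_def split: if_splits)
  moreover have "cdeg U (\<lambda>x. recolor f u v i x y) j \<le> b j y" if "y \<in> V" "j < l" for y j
    using col_recolor[of U u f v i y j] assms that
    by (auto simp: bounded_by_def split: if_splits)
  moreover have "recolor f u v i x y \<le> l" for x y
    using assms by (auto simp: recolor_def bounded_by_def)
  ultimately show ?thesis by (auto simp: bounded_by_def)
qed

lemma sum_cdeg_recolor:
  assumes "finite U" "finite V" "u \<in> U" "v \<in> V"
  shows "(\<Sum>x\<in>U. cdeg V (recolor f u v k x) i) + of_bool (f u v = i)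
    = (\<Sum>x\<in>U. cdeg V (f x) i) + of_bool (k = i)"
proof -
  have "(\<Sum>x\<in>U. cdeg V (recolor f u v k x) i + of_bool (x = u \<and> f u v = i))
    = (\<Sum>x\<in>U. cdeg V (f x) i + of_bool (x = u \<and> k = i))"
    using row_recolor[of V v f u k _ i] assms by (intro sum.cong) auto
  moreover have "(\<Sum>x\<in>U. of_bool (x = u \<and> Q)) = (of_bool Q :: nat)" for Q
    using assms by (cases Q) (auto simp: of_bool_def sum.delta)
  ultimately show ?thesis by (simp add: sum.distrib)
qed

text \<open>
  A partial colouring with the largest number of edges is exact: a missing edge of type \<open>i\<close> at \<open>u\<close>
  and \<open>v\<close> is inserted directly or by replacing an edge \<open>(u', v')\<close> of type \<open>i\<close> with \<open>(u, v')\<close> and \<open>(u', v)\<close>.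
  If direct insertion is impossible, at most \<open>l B\<^sup>2\<close> edges of type \<open>i\<close> are missing, and at most \<open>2 l B\<^sup>2\<close>
  of the present ones are unsuitable for the replacement.
\<close>

lemma exact_colouring_exists:
  fixes U :: "'a set" and V :: "'b set"
  assumes fin: "finite U" "finite V"
    and aB: "\<And>i u. i < l \<Longrightarrow> u \<in> U \<Longrightarrow> a i u \<le> B"
    and bB: "\<And>i v. i < l \<Longrightarrow> v \<in> V \<Longrightarrow> b i v \<le> B"
    and eq: "\<And>i. i < l \<Longrightarrow> (\<Sum>u\<in>U. a i u) = (\<Sum>v\<in>V. b i v)"
    and large: "\<And>i. i < l \<Longrightarrow> (\<Sum>u\<in>U. a i u) = 0 \<or> (\<Sum>u\<in>U. a i u) > 3 * l * B * B"
  shows "\<exists>f. (\<forall>u v. f u v \<le> l) \<and> (\<forall>i<l. \<forall>u\<in>U. cdeg V (f u) i = a i u) \<and>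
    (\<forall>i<l. \<forall>v\<in>V. cdeg U (\<lambda>u. f u v) i = b i v)"
proof -
  let ?W = "bounded_by l U V a b"
  \<comment> \<open>The number of edges between \<open>U\<close> and \<open>V\<close>, which is
    maximised below, starting from the empty colouring.\<close>
  define num where "num f = (\<Sum>i<l. \<Sum>u\<in>U. cdeg V (f u) i)" for f
  have "?W (\<lambda>_ _. l)" by (auto simp: bounded_by_def cdeg_def)
  moreover have "\<forall>f. ?W f \<longrightarrow> num f < Suc (\<Sum>i<l. \<Sum>u\<in>U. a i u)"
    unfolding num_def bounded_by_def less_Suc_eq_le by (auto intro!: sum_mono)
  ultimately obtain f where f: "?W f" and max: "\<And>g. ?W g \<Longrightarrow> num g \<le> num f"
    using ex_has_greatest_nat[of ?W "\<lambda>_ _. l" num] by blast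
  have num_recolor: "num (recolor g u v k) + of_bool (g u v < l) = num g + of_bool (k < l)"
    if "u \<in> U" "v \<in> V" for g u v k
  proof -
    have "(\<Sum>i<l. (\<Sum>x\<in>U. cdeg V (recolor g u v k x) i) + of_bool (g u v = i))
      = (\<Sum>i<l. (\<Sum>x\<in>U. cdeg V (g x) i) + of_bool (k = i))"
      using sum_cdeg_recolor[OF fin that] by simp
    moreover have "(\<Sum>i<l. of_bool (c = i)) = (of_bool (c < l) :: nat)" for c
      by (auto simp: of_bool_def sum.delta)
    ultimately show ?thesis by (simp add: num_def sum.distrib)
  qed
  have row: "cdeg V (f u) i \<le> a i u" if "i < l" "u \<in> U" for i u
    using f that by (auto simp: bounded_by_def)
  have col: "cdeg U (\<lambda>u. f u v) i \<le> b i v" if "i < l" "v \<in> V" for i v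
    using f that by (auto simp: bounded_by_def)
  have le_l: "f u v \<le> l" for u v using f by (auto simp: bounded_by_def)
  \<comment> \<open>Since no degree exceeds its target, equality of the totals forces equality at
    every vertex by \<open>sum_mono_inv\<close>.\<close>
  have total: "(\<Sum>u\<in>U. cdeg V (f u) i) = (\<Sum>u\<in>U. a i u)" if i: "i < l" for i
  proof (rule ccontr)
    assume neq: "(\<Sum>u\<in>U. cdeg V (f u) i) \<noteq> (\<Sum>u\<in>U. a i u)"
    have "(\<Sum>u\<in>U. cdeg V (f u) i) \<le> (\<Sum>u\<in>U. a i u)"
      by (intro sum_mono row i)
    with neq have less: "(\<Sum>u\<in>U. cdeg V (f u) i) < (\<Sum>u\<in>U. a i u)" by simp
    then have z: "(\<Sum>u\<in>U. a i u) > 3 * l * B * B" using large[OF i] by auto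
    obtain u where u: "u \<in> U" "cdeg V (f u) i < a i u"
      using less by (metis (no_types, lifting) leD not_le_imp_less sum_mono)
    have "(\<Sum>v\<in>V. cdeg U (\<lambda>u. f u v) i) < (\<Sum>v\<in>V. b i v)"
      using less eq[OF i] cdeg_double_count[OF fin, of f i] by simp
    then obtain v where v: "v \<in> V" "cdeg U (\<lambda>u. f u v) i < b i v"
      by (metis (no_types, lifting) leD not_le_imp_less sum_mono)
    \<comment> \<open>A deficient \<open>x\<close> not joined to \<open>v\<close> would admit a new
      edge. So all deficient left vertices lie in \<open>?Nv\<close>, which limits the total deficit
      to \<open>l * B * B\<close>.\<close>
    have no_direct: "f x v < l" if x: "x \<in> U" "cdeg V (f x) i < a i x" for x
    proof (rule ccontr)
      assume "\<not> f x v < l"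
      with le_l[of x v] have fxv: "f x v = l" by simp
      have "?W (recolor f x v i)"
        using bounded_by_add_edge[OF f fin x(1) v(1) i fxv x(2) v(2)] .
      then have "num (recolor f x v i) \<le> num f" by (rule max)
      with num_recolor[OF x(1) v(1), of f i] fxv i show False by simp
    qed
    let ?Nv = "{x \<in> U. f x v < l}" and ?Nu = "{y \<in> V. f u y < l}"
    have Nv: "card ?Nv \<le> l * B"
      using col bB v(1) by (intro card_colored_le fin) (meson order_trans)
    have Nu: "card ?Nu \<le> l * B"
      using row aB u(1) by (intro card_colored_le fin) (meson order_trans)
    have "(\<Sum>x\<in>U. a i x) \<le> (\<Sum>x\<in>U. cdeg V (f x) i + (if x \<in> ?Nv then B else 0))"
    proof (intro sum_mono)
      fix x assume x: "x \<in> U"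
      show "a i x \<le> cdeg V (f x) i + (if x \<in> ?Nv then B else 0)"
        using no_direct[OF x] aB[OF i x] x by (cases "cdeg V (f x) i < a i x") auto
    qed
    also have "\<dots> = (\<Sum>x\<in>U. cdeg V (f x) i) + card ?Nv * B"
      using fin by (simp add: sum.distrib sum.If_cases Int_def)
    finally have many: "(\<Sum>x\<in>U. a i x) \<le> (\<Sum>x\<in>U. cdeg V (f x) i) + l * B * B"
      using mult_right_mono[OF Nv, of B] by linarith
    \<comment> \<open>Otherwise each edge of type \<open>i\<close> starts in \<open>?Nv\<close> or
      ends in \<open>?Nu\<close>. There are at most \<open>2 * l * B * B\<close> such edges, so
      adding the deficit bounds the target sum by \<open>3 * l * B * B\<close>.\<close>
    have "\<exists>x\<in>U. \<exists>y\<in>V. f x y = i \<and> f x v = l \<and> f u y = l"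
    proof (rule ccontr)
      assume none: "\<not> ?thesis"
      let ?S = "\<lambda>x. {y \<in> V. f x y = i}"
      have sub: "(SIGMA x:U. ?S x) \<subseteq> (SIGMA x:?Nv. ?S x) \<union> (\<lambda>(y, x). (x, y)) ` (SIGMA y:?Nu. {x \<in> U. f x y = i})"
        using none le_l by (force simp: le_less image_iff)
      have "(\<Sum>x\<in>U. cdeg V (f x) i) = card (SIGMA x:U. ?S x)"
        using fin by (simp add: cdeg_def)
      also have "\<dots> \<le> card ((SIGMA x:?Nv. ?S x) \<union> (\<lambda>(y, x). (x, y)) ` (SIGMA y:?Nu. {x \<in> U. f x y = i}))"
        using fin by (intro card_mono sub) auto
      also have "\<dots> \<le> card (SIGMA x:?Nv. ?S x) + card (SIGMA y:?Nu. {x \<in> U. f x y = i})"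
        by (intro card_Un_le[THEN order_trans] add_mono card_image_le finite_SigmaI order_refl)
          (use fin in auto)
      also have "\<dots> = (\<Sum>x\<in>?Nv. cdeg V (f x) i) + (\<Sum>y\<in>?Nu. cdeg U (\<lambda>x. f x y) i)"
        using fin by (simp add: cdeg_def)
      also have "\<dots> \<le> (\<Sum>x\<in>?Nv. B) + (\<Sum>y\<in>?Nu. B)"
        using order_trans[OF row[OF i] aB[OF i]] order_trans[OF col[OF i] bB[OF i]]
        by (intro add_mono sum_mono) auto
      also have "\<dots> \<le> 2 * l * B * B"
        using mult_right_mono[OF Nv, of B] mult_right_mono[OF Nu, of B] unfolding sum_constant of_nat_id
        by linarith
      finally show False using many z by simp
    qed
    then obtain x y where xy: "x \<in> U" "y \<in> V" "f x y = i" "f x v = l" "f u y = l" by blast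
    have ne: "x \<noteq> u" "y \<noteq> v" using xy i by auto
    \<comment> \<open>First \<open>(x, y)\<close> is deleted, then \<open>(u, y)\<close> and
      \<open>(x, v)\<close> are inserted. The deletion frees one unit at \<open>x\<close> and at
      \<open>y\<close>, so both insertions respect the bounds, and the number of edges grows by one
      overall.\<close>
    let ?g = "recolor f x y l"
    let ?h = "recolor ?g u y i"
    have row_g: "cdeg V (?g x') j + of_bool (x' = x \<and> i = j) = cdeg V (f x') j + of_bool (x' = x \<and> l = j)" for x' j
      using row_recolor[of V y f x l x' j] fin xy by simp
    have col_g: "cdeg U (\<lambda>x. ?g x y') j + of_bool (y' = y \<and> i = j) = cdeg U (\<lambda>x. f x y') j + of_bool (y' = y \<and> l = j)" for y' j
      using col_recolor[of U x f y l y' j] fin xy by simp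
    have g: "?W ?g"
    proof -
      have "cdeg V (?g x') j \<le> a j x'" if "x' \<in> U" "j < l" for x' j
        using row_g[of x' j] row[of j x'] that by (auto split: if_splits)
      moreover have "cdeg U (\<lambda>x. ?g x y') j \<le> b j y'" if "y' \<in> V" "j < l" for y' j
        using col_g[of y' j] col[of j y'] that by (auto split: if_splits)
      ultimately show ?thesis using le_l by (auto simp: bounded_by_def recolor_def)
    qed
    have guy: "?g u y = l" using ne xy by (auto simp: recolor_def)
    have "cdeg V (?g u) i < a i u" using row_g[of u i] ne u i by simp
    moreover have "cdeg U (\<lambda>x. ?g x y) i < b i y" using col_g[of y i] col[of i y] i xy by simp
    ultimately have h: "?W ?h"
      using bounded_by_add_edge[OF g fin u(1) xy(2) i guy] by simp
    have hxv: "?h x v = l" using ne xy by (auto simp: recolor_def)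
    have "cdeg V (?h x) i < a i x"
      using row_recolor[of V y ?g u i x i] row_g[of x i] row[of i x] ne i xy fin by simp
    moreover have "cdeg U (\<lambda>x. ?h x v) i < b i v"
      using col_recolor[of U u ?g y i v i] col_g[of v i] ne u v fin by simp
    ultimately have "?W (recolor ?h x v i)"
      using bounded_by_add_edge[OF h fin xy(1) v(1) i hxv] by simp
    then have "num (recolor ?h x v i) \<le> num f" by (rule max)
    moreover have "num (recolor ?h x v i) = num ?h + 1"
      using num_recolor[OF xy(1) v(1), of ?h i] hxv i by simp
    moreover have "num ?h = num ?g + 1"
      using num_recolor[OF u(1) xy(2), of ?g i] guy i by simp
    moreover have "num ?g + 1 = num f"
      using num_recolor[OF xy(1,2), of f l] xy(3) i by simp
    ultimately show False by simp
  qed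
  have "cdeg V (f u) i = a i u" if "i < l" "u \<in> U" for i u
    by (rule sum_mono_inv[OF total[OF that(1)] row[OF that(1)] that(2) fin(1)])
  moreover have "cdeg U (\<lambda>u. f u v) i = b i v" if "i < l" "v \<in> V" for i v
    by (rule sum_mono_inv[OF _ col[OF that(1)] that(2) fin(2)])
      (use total[OF that(1)] cdeg_double_count[OF fin, of f i] eq[OF that(1)] in simp)
  ultimately show ?thesis using le_l by blast
qed

section \<open>Few vertices with a degree above their bound\<close>

definition fits :: "nat \<Rightarrow> 'a set \<Rightarrow> 'b set \<Rightarrow> (nat \<Rightarrow> 'a \<Rightarrow> bnum) \<Rightarrow> (nat \<Rightarrow> 'b \<Rightarrow> bnum)
    \<Rightarrow> ('a \<Rightarrow> 'b \<Rightarrow> nat) \<Rightarrow> bool" where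
  "fits l U V \<alpha> \<beta> f \<longleftrightarrow> (\<forall>u v. f u v \<le> l) \<and>
     (\<forall>i<l. \<forall>u\<in>U. meets (cdeg V (f u) i) (\<alpha> i u)) \<and>
     (\<forall>i<l. \<forall>v\<in>V. meets (cdeg U (\<lambda>u. f u v) i) (\<beta> i v))"

text \<open>The summand 1 makes every deletion a strict decrease, even between two vertices numbered
  0; the vertex numbers make moving an end point to a smaller vertex a strict decrease.\<close>

definition weight :: "nat \<Rightarrow> nat set \<Rightarrow> nat set \<Rightarrow> (nat \<Rightarrow> nat \<Rightarrow> nat) \<Rightarrow> nat" where
  "weight l U V f = (\<Sum>u\<in>U. \<Sum>v\<in>V. if f u v < l then u + v + 1 else 0)"

definition minimal :: "nat \<Rightarrow> nat set \<Rightarrow> nat set \<Rightarrow> (nat \<Rightarrow> nat \<Rightarrow> bnum) \<Rightarrow> (nat \<Rightarrow> nat \<Rightarrow> bnum)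
    \<Rightarrow> (nat \<Rightarrow> nat \<Rightarrow> nat) \<Rightarrow> bool" where
  "minimal l U V \<alpha> \<beta> f \<longleftrightarrow> finite U \<and> finite V \<and> fits l U V \<alpha> \<beta> f \<and>
     (\<forall>g. fits l U V \<alpha> \<beta> g \<longrightarrow> weight l U V f \<le> weight l U V g)"

section \<open>Changes that keep the degree constraints and lower the weight\<close>

lemma bfloor_le_meets: "meets x b \<Longrightarrow> bfloor b \<le> x"
  by (cases b) auto

lemma meets_bfloor: "meets (bfloor b) b"
  by (cases b) auto

text \<open>Excess is possible only for a bound of the form \<open>AtLeast\<close>, which every
  value from its floor upwards meets.\<close>

lemma meets_if_excess: "meets x b \<Longrightarrow> bfloor b < x \<Longrightarrow> bfloor b \<le> y \<Longrightarrow> meets y b"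
  by (cases b) auto

lemma fits_flip: "fits l U V \<alpha> \<beta> f \<Longrightarrow> fits l V U \<beta> \<alpha> (\<lambda>v u. f u v)"
  by (auto simp: fits_def)

lemma weight_flip: "weight l V U (\<lambda>v u. f u v) = weight l U V f"
  unfolding weight_def by (subst sum.swap) (intro sum.cong, auto)

text \<open>The weight is symmetric in the two sides, so results about exceeding right vertices
  transfer to left vertices.\<close>

lemma minimal_flip:
  assumes "minimal l U V \<alpha> \<beta> f"
  shows "minimal l V U \<beta> \<alpha> (\<lambda>v u. f u v)"
proof -
  have "weight l U V f \<le> weight l V U g" if "fits l V U \<beta> \<alpha> g" for g
    using assms fits_flip[OF that] weight_flip[of l V U "\<lambda>u v. g v u"] by (simp add: minimal_def)
  then show ?thesis
    using assms fits_flip[of l U V \<alpha> \<beta> f] unfolding minimal_def weight_flip[of l V U f]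
    by simp
qed

lemma weight_recolor:
  assumes "finite U" "finite V" "u \<in> U" "v \<in> V"
  shows "weight l U V (recolor f u v k) + (if f u v < l then u + v + 1 else 0)
    = weight l U V f + (if k < l then u + v + 1 else 0)"
proof -
  have split: "weight l U V g = (if g u v < l then u + v + 1 else 0) +
     (\<Sum>(x, y)\<in>U \<times> V - {(u, v)}. if g x y < l then x + y + 1 else 0)" for g
    unfolding weight_def sum.cartesian_product
    using assms by (subst sum.remove[of _ "(u, v)"]) auto
  have "(\<Sum>(x, y)\<in>U \<times> V - {(u, v)}. if recolor f u v k x y < l then x + y + 1 else 0)
    = (\<Sum>(x, y)\<in>U \<times> V - {(u, v)}. if f x y < l then x + y + 1 else 0)"
    by (rule sum.cong) (auto simp: recolor_def split: if_splits)
  then show ?thesis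
    unfolding split[of f] split[of "recolor f u v k"] by (simp add: recolor_def)
qed

text \<open>Otherwise the edge could be deleted: both degrees stay at or above their floors while
  the weight drops.\<close>

lemma minimal_not_both_excess:
  assumes min: "minimal l U V \<alpha> \<beta> f" and uv: "u \<in> U" "v \<in> V" "i < l" "f u v = i"
    and ex: "bfloor (\<alpha> i u) < cdeg V (f u) i"
  shows "cdeg U (\<lambda>x. f x v) i \<le> bfloor (\<beta> i v)"
proof (rule ccontr)
  assume "\<not> ?thesis"
  then have ex': "bfloor (\<beta> i v) < cdeg U (\<lambda>x. f x v) i" by simp
  have fin: "finite U" "finite V" and fit: "fits l U V \<alpha> \<beta> f"
    using min by (auto simp: minimal_def)
  let ?g = "recolor f u v l"
  have "meets (cdeg V (?g x) j) (\<alpha> j x)" if "x \<in> U" "j < l" for x j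
  proof -
    have m: "meets (cdeg V (f x) j) (\<alpha> j x)" using fit that by (auto simp: fits_def)
    show ?thesis
      using row_recolor[of V v f u l x j] m meets_if_excess[OF m] fin uv ex that
      by (cases "x = u \<and> j = i") auto
  qed
  moreover have "meets (cdeg U (\<lambda>x. ?g x y) j) (\<beta> j y)" if "y \<in> V" "j < l" for y j
  proof -
    have m: "meets (cdeg U (\<lambda>x. f x y) j) (\<beta> j y)" using fit that by (auto simp: fits_def)
    show ?thesis
      using col_recolor[of U u f v l y j] m meets_if_excess[OF m] fin uv ex' that
      by (cases "y = v \<and> j = i") auto
  qed
  ultimately have "fits l U V \<alpha> \<beta> ?g"
    using fit by (auto simp: fits_def recolor_def)
  then have "weight l U V f \<le> weight l U V ?g" using min by (auto simp: minimal_def)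
  then show False using weight_recolor[OF fin uv(1,2), of l f l] uv by simp
qed

text \<open>Otherwise the edge \<open>(u, v)\<close> could be moved to \<open>(u, v')\<close>. The
  degrees of \<open>u\<close> are unchanged, \<open>v\<close> can spare an edge, \<open>v'\<close>
  accepts any further one, and the weight drops by \<open>v - v'\<close>.\<close>

lemma minimal_excess_adjacent:
  assumes min: "minimal l U V \<alpha> \<beta> f"
    and uv: "u \<in> U" "v \<in> V" "v' \<in> V" "v' < v" "i < l" "f u v = i"
    and ex: "bfloor (\<beta> i v) < cdeg U (\<lambda>x. f x v) i" "bfloor (\<beta> i v') < cdeg U (\<lambda>x. f x v') i"
  shows "f u v' < l"
proof (rule ccontr)
  assume neg: "\<not> f u v' < l"
  have fin: "finite U" "finite V" and fit: "fits l U V \<alpha> \<beta> f"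
    using min by (auto simp: minimal_def)
  then have l: "f u v' = l" using neg by (metis fits_def le_neq_implies_less)
  let ?g = "recolor f u v l"
  let ?h = "recolor ?g u v' i"
  have gl: "?g u v' = l" using l uv by (simp add: recolor_def)
  have "meets (cdeg V (?h x) j) (\<alpha> j x)" if "x \<in> U" "j < l" for x j
  proof -
    have m: "meets (cdeg V (f x) j) (\<alpha> j x)" using fit that by (auto simp: fits_def)
    have "cdeg V (?h x) j = cdeg V (f x) j"
      using row_recolor[of V v f u l x j] row_recolor[of V v' ?g u i x j] fin uv gl that
      by (auto split: if_splits)
    then show ?thesis using m by simp
  qed
  moreover have "meets (cdeg U (\<lambda>x. ?h x y) j) (\<beta> j y)" if "y \<in> V" "j < l" for y j
  proof -
    have m: "meets (cdeg U (\<lambda>x. f x y) j) (\<beta> j y)" using fit that by (auto simp: fits_def)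
    note cols = col_recolor[of U u f v l y j] col_recolor[of U u ?g v' i y j]
    consider "y = v" "j = i" | "y = v'" "j = i" | "\<not> (y = v \<and> j = i)" "\<not> (y = v' \<and> j = i)" by blast
    then show ?thesis
    proof cases
      case 1
      then show ?thesis using cols meets_if_excess[OF m] fin uv ex that gl by auto
    next
      case 2
      then show ?thesis using cols meets_if_excess[OF m] fin uv ex that gl by auto
    next
      case 3
      then have "cdeg U (\<lambda>x. ?h x y) j = cdeg U (\<lambda>x. f x y) j"
        using cols fin uv gl that by (auto split: if_splits)
      then show ?thesis using m by simp
    qed
  qed
  ultimately have "fits l U V \<alpha> \<beta> ?h"
    using fit uv by (auto simp: fits_def recolor_def)
  then have "weight l U V f \<le> weight l U V ?h" using min by (auto simp: minimal_def)
  then show False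
    using weight_recolor[OF fin uv(1,2), of l f l] weight_recolor[OF fin uv(1,3), of l ?g i] gl uv
    by simp
qed

text \<open>Collects the \<open>r\<close> smallest elements by repeatedly adding the minimum of the
  rest.\<close>

lemma ex_initial_segment:
  fixes A :: "nat set"
  assumes "finite A" "r \<le> card A"
  shows "\<exists>L\<subseteq>A. card L = r \<and> (\<forall>x\<in>L. \<forall>y\<in>A - L. x < y)"
  using assms(2)
proof (induction r)
  case 0
  show ?case by (intro exI[of _ "{}"]) simp
next
  case (Suc r)
  then obtain L where L: "L \<subseteq> A" "card L = r" "\<forall>x\<in>L. \<forall>y\<in>A - L. x < y" by auto
  have finL: "finite L" using L assms finite_subset by blast
  have ne: "A - L \<noteq> {}" using Suc.prems L by auto
  let ?m = "Min (A - L)"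
  have m: "?m \<in> A - L" using ne assms by (intro Min_in) auto
  have "?m < y" if "y \<in> A - insert ?m L" for y
  proof -
    have "?m \<le> y" using that assms by (intro Min_le) auto
    moreover have "?m \<noteq> y" using that by auto
    ultimately show ?thesis by simp
  qed
  then show ?case using L m finL
    by (intro exI[of _ "insert ?m L"]) auto
qed

text \<open>Let \<open>L\<close> be the \<open>2 * l * B + 1\<close> smallest exceeding vertices,
  \<open>H\<close> the other ones and \<open>X\<close> the neighbours of \<open>H\<close> in type
  \<open>i\<close>. Every vertex of \<open>X\<close> is joined to all of \<open>L\<close>, but few
  such edges are possible, so \<open>X\<close> is small. As vertices of \<open>X\<close> do not
  exceed in type \<open>i\<close>, they reach at most \<open>card X * B\<close> vertices, and these
  include all of \<open>H\<close>.\<close>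

lemma card_excess_le:
  assumes min: "minimal l U V \<alpha> \<beta> f"
    and \<alpha>B: "\<And>i u. i < l \<Longrightarrow> u \<in> U \<Longrightarrow> bfloor (\<alpha> i u) \<le> B"
    and \<beta>B: "\<And>i v. i < l \<Longrightarrow> v \<in> V \<Longrightarrow> bfloor (\<beta> i v) \<le> B"
    and i: "i < l"
  shows "card {v \<in> V. bfloor (\<beta> i v) < cdeg U (\<lambda>u. f u v) i} \<le> 2 * l * B * B + 2 * l * B + 1"
    (is "card ?A \<le> _")
proof (cases "card ?A \<le> 2 * l * B + 1")
  case False
  have fin: "finite U" "finite V" and fit: "fits l U V \<alpha> \<beta> f"
    using min by (auto simp: minimal_def)
  obtain L where L: "L \<subseteq> ?A" "card L = 2 * l * B + 1" "\<forall>x\<in>L. \<forall>y\<in>?A - L. x < y"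
    using ex_initial_segment[of ?A "2 * l * B + 1"] fin False by auto
  define H where "H = ?A - L"
  define X where "X = {u \<in> U. \<exists>v\<in>H. f u v = i}"
  have finL: "finite L" and finX: "finite X" and finH: "finite H"
    using L fin by (auto intro: finite_subset simp: X_def H_def)
  have excess: "v \<in> V" "bfloor (\<beta> i v) < cdeg U (\<lambda>u. f u v) i" if "v \<in> L \<or> v \<in> H" for v
    using that L by (auto simp: H_def)
  have tight: "cdeg V (f u) i \<le> B" if "u \<in> X" for u
  proof -
    obtain w where w: "u \<in> U" "w \<in> H" "f u w = i" using \<open>u \<in> X\<close> by (auto simp: X_def)
    then show ?thesis
      using minimal_not_both_excess[OF min w(1) _ i w(3)] excess[of w] \<alpha>B[OF i w(1)] by linarith
  qed
  have adj: "f u v < l" if uv: "u \<in> X" "v \<in> L" for u v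
  proof -
    obtain w where w: "u \<in> U" "w \<in> H" "f u w = i" using uv by (auto simp: X_def)
    moreover have "v < w" using L w uv by (auto simp: H_def)
    ultimately show ?thesis
      using minimal_excess_adjacent[OF min, of u w v i] excess[of v] excess[of w] uv i by auto
  qed
  \<comment> \<open>An exceeding degree is positive, so every vertex of \<open>H\<close> has a
    neighbour of type \<open>i\<close>.\<close>
  have "H \<subseteq> (\<Union>u\<in>X. {v \<in> V. f u v = i})"
  proof
    fix v assume v: "v \<in> H"
    then have "cdeg U (\<lambda>u. f u v) i > 0" using excess[of v] by linarith
    then obtain u where "u \<in> U" "f u v = i" using fin by (auto simp: cdeg_pos_iff)
    then show "v \<in> (\<Union>u\<in>X. {v \<in> V. f u v = i})"
      using v excess[of v] by (auto simp: X_def)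
  qed
  then have "card H \<le> card (\<Union>u\<in>X. {v \<in> V. f u v = i})"
    using fin finX by (intro card_mono) auto
  also have "\<dots> \<le> (\<Sum>u\<in>X. cdeg V (f u) i)"
    unfolding cdeg_def by (intro card_UN_le finX)
  also have "\<dots> \<le> (\<Sum>u\<in>X. B)" by (intro sum_mono tight)
  finally have cardH: "card H \<le> card X * B" by simp
  let ?R = "\<lambda>u. {v \<in> V. f u v < l \<and> cdeg V (f u) (f u v) \<le> B}"
  let ?C = "\<lambda>v. {u \<in> U. f u v < l \<and> cdeg U (\<lambda>u. f u v) (f u v) \<le> B}"
  have R: "card (?R u) \<le> l * B" for u
  proof -
    have "?R u = (\<Union>j\<in>{j. j < l \<and> cdeg V (f u) j \<le> B}. {v \<in> V. f u v = j})" by auto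
    then have "card (?R u) \<le> (\<Sum>j\<in>{j. j < l \<and> cdeg V (f u) j \<le> B}. cdeg V (f u) j)"
      unfolding cdeg_def by (simp add: card_UN_le)
    also have "\<dots> \<le> card {j. j < l \<and> cdeg V (f u) j \<le> B} * B"
      by (rule sum_bounded_above[where K = B, simplified]) auto
    also have "\<dots> \<le> card {..<l} * B" by (intro mult_right_mono card_mono) auto
    finally show ?thesis by simp
  qed
  have C: "card (?C v) \<le> l * B" for v
  proof -
    have "?C v = (\<Union>j\<in>{j. j < l \<and> cdeg U (\<lambda>u. f u v) j \<le> B}. {u \<in> U. f u v = j})" by auto
    then have "card (?C v) \<le> (\<Sum>j\<in>{j. j < l \<and> cdeg U (\<lambda>u. f u v) j \<le> B}. cdeg U (\<lambda>u. f u v) j)"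
      unfolding cdeg_def by (simp add: card_UN_le)
    also have "\<dots> \<le> card {j. j < l \<and> cdeg U (\<lambda>u. f u v) j \<le> B} * B"
      by (rule sum_bounded_above[where K = B, simplified]) auto
    also have "\<dots> \<le> card {..<l} * B" by (intro mult_right_mono card_mono) auto
    finally show ?thesis by simp
  qed
  \<comment> \<open>Each edge between \<open>X\<close> and \<open>L\<close> has an end point at
    which its own type has degree at most \<open>B\<close>; the edge is charged to that end point,
    and each vertex is charged at most \<open>l * B\<close> times.\<close>
  have "X \<times> L \<subseteq> (SIGMA u:X. ?R u) \<union> (\<lambda>(v, u). (u, v)) ` (SIGMA v:L. ?C v)"
  proof
    fix p assume "p \<in> X \<times> L"
    then obtain u v where p: "p = (u, v)" "u \<in> X" "v \<in> L" by auto
    have uv: "u \<in> U" "v \<in> V" "f u v < l" using p adj excess[of v] by (auto simp: X_def)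
    have "cdeg V (f u) (f u v) \<le> B \<or> cdeg U (\<lambda>u. f u v) (f u v) \<le> B"
      using minimal_not_both_excess[OF min uv refl] \<alpha>B[OF uv(3,1)] \<beta>B[OF uv(3,2)] by linarith
    then show "p \<in> (SIGMA u:X. ?R u) \<union> (\<lambda>(v, u). (u, v)) ` (SIGMA v:L. ?C v)"
      using p uv by (auto simp: image_iff)
  qed
  then have "card (X \<times> L) \<le> card ((SIGMA u:X. ?R u) \<union> (\<lambda>(v, u). (u, v)) ` (SIGMA v:L. ?C v))"
    using finX finL fin by (intro card_mono) auto
  also have "\<dots> \<le> card (SIGMA u:X. ?R u) + card (SIGMA v:L. ?C v)"
    by (intro card_Un_le[THEN order_trans] add_mono card_image_le finite_SigmaI order_refl)
      (use fin finL in auto)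
  also have "\<dots> = (\<Sum>u\<in>X. card (?R u)) + (\<Sum>v\<in>L. card (?C v))"
    using fin finX finL by simp
  also have "\<dots> \<le> (\<Sum>u\<in>X. l * B) + (\<Sum>v\<in>L. l * B)"
    by (intro add_mono sum_mono R C)
  finally have "card X * (2 * (l * B) + 1) \<le> (card X + (2 * (l * B) + 1)) * (l * B)"
    using L(2) by (simp add: card_cartesian_product algebra_simps)
  \<comment> \<open>The exact bound \<open>(l * B) * (2 * (l * B) + 1)\<close> is rounded up so that
    the factor \<open>l * B + 1\<close> cancels.\<close>
  then have "card X * (l * B + 1) \<le> (2 * (l * B)) * (l * B + 1)"
    by (simp add: algebra_simps)
  then have "card X \<le> 2 * (l * B)" by (simp only: mult_le_cancel2)
  then have "card X * B \<le> 2 * l * B * B" by simp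
  with cardH have "card H \<le> 2 * l * B * B" by linarith
  moreover have "card ?A = card H + card L"
    using L False finL unfolding H_def by (simp add: card_Diff_subset)
  ultimately show ?thesis using L(2) by simp
qed simp

section \<open>Elimination of rare edge types and the normal form\<close>

text \<open>The vertices put into \<open>U\<^sub>0\<close> in addition are the end points of the edge types that would
  otherwise have between \<open>1\<close> and \<open>T\<close> edges outside of \<open>U\<^sub>0\<close> and \<open>V\<^sub>0\<close>.\<close>

lemma remove_small_types:
  assumes fin: "finite U" "finite V" and U0: "U0 \<subseteq> U"
  shows "\<exists>U1. U0 \<subseteq> U1 \<and> U1 \<subseteq> U \<and> card U1 \<le> card U0 + l * T \<and>
    (\<forall>i<l. (\<Sum>u\<in>U - U1. cdeg V (f u) i) = 0 \<or> (\<Sum>u\<in>U - U1. cdeg V (f u) i) > T)"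
proof -
  \<comment> \<open>\<open>I\<close> is a set of types that can be eliminated at a cost of at most
    \<open>T\<close> vertices each; a largest such set is taken.\<close>
  define P where "P I \<longleftrightarrow> I \<subseteq> {..<l} \<and> (\<exists>U1. U0 \<subseteq> U1 \<and> U1 \<subseteq> U \<and> card U1 \<le> card U0 + card I * T \<and>
    (\<forall>i\<in>I. (\<Sum>u\<in>U - U1. cdeg V (f u) i) = 0))" for I
  have "P {}" using U0 by (auto simp: P_def)
  moreover have "\<forall>I. P I \<longrightarrow> card I < Suc l"
    using card_mono[of "{..<l}"] by (auto simp: P_def less_Suc_eq_le)
  ultimately obtain I where I: "P I" and max: "\<And>J. P J \<Longrightarrow> card J \<le> card I"
    using ex_has_greatest_nat[of P "{}" card] by blast
  from I obtain U1 where U1: "U0 \<subseteq> U1" "U1 \<subseteq> U" "card U1 \<le> card U0 + card I * T"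
    "\<forall>i\<in>I. (\<Sum>u\<in>U - U1. cdeg V (f u) i) = 0" by (auto simp: P_def)
  have Il: "I \<subseteq> {..<l}" using I by (auto simp: P_def)
  then have finI: "finite I" by (rule finite_subset) simp
  have "(\<Sum>u\<in>U - U1. cdeg V (f u) i) = 0 \<or> (\<Sum>u\<in>U - U1. cdeg V (f u) i) > T" if i: "i < l" for i
  proof (rule ccontr)
    assume neg: "\<not> ?thesis"
    then have iI: "i \<notin> I" using U1 by auto
    \<comment> \<open>Adding these at most \<open>T\<close> vertices eliminates type
      \<open>i\<close> as well, and the types in \<open>I\<close> stay eliminated because their sums
      only lose terms. This contradicts the choice of \<open>I\<close>.\<close>
    let ?S = "{u \<in> U - U1. cdeg V (f u) i > 0}"
    have "card ?S = (\<Sum>u\<in>?S. 1)" by simp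
    also have "\<dots> \<le> (\<Sum>u\<in>?S. cdeg V (f u) i)" by (intro sum_mono) auto
    also have "\<dots> \<le> (\<Sum>u\<in>U - U1. cdeg V (f u) i)" using fin by (intro sum_mono2) auto
    finally have S: "card ?S \<le> T" using neg by simp
    have "card (U1 \<union> ?S) \<le> card U0 + card (insert i I) * T"
      using card_Un_le[of U1 ?S] S U1(3) iI finI by simp
    moreover have "(\<Sum>u\<in>U - (U1 \<union> ?S). cdeg V (f u) j) = 0" if "j \<in> insert i I" for j
    proof (cases "j = i")
      case False
      then show ?thesis using U1(4) that fin by auto
    qed (auto intro!: sum.neutral)
    ultimately have "P (insert i I)" unfolding P_def
      using U1 i Il by (intro conjI exI[of _ "U1 \<union> ?S"]) auto
    then show False using max[of "insert i I"] iI finI by simp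
  qed
  moreover have "card U1 \<le> card U0 + l * T"
  proof -
    have "card I \<le> l" using card_mono[OF _ Il] by simp
    then have "card I * T \<le> l * T" by (rule mult_right_mono) simp
    then show ?thesis using U1(3) by linarith
  qed
  ultimately show ?thesis using U1(1,2) by blast
qed

text \<open>In a fitting colouring of least weight the exceeding vertices become exceptional on both
  sides. Then only the left set is enlarged to remove rare types: one exceptional end point suffices
  to take an edge out of the remainder.\<close>

lemma normal_form:
  fixes U V :: "nat set"
  assumes fin: "finite U" "finite V" and fit: "fits l U V \<alpha> \<beta> f"
    and \<alpha>B: "\<And>i u. i < l \<Longrightarrow> u \<in> U \<Longrightarrow> bfloor (\<alpha> i u) \<le> B"
    and \<beta>B: "\<And>i v. i < l \<Longrightarrow> v \<in> V \<Longrightarrow> bfloor (\<beta> i v) \<le> B"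
  shows "\<exists>g U0 V0. fits l U V \<alpha> \<beta> g \<and> U0 \<subseteq> U \<and> V0 \<subseteq> V \<and>
    card U0 \<le> l * (2 * l * B * B + 2 * l * B + 1) + l * T \<and>
    card V0 \<le> l * (2 * l * B * B + 2 * l * B + 1) + l * T \<and>
    (\<forall>i<l. \<forall>u\<in>U - U0. cdeg V (g u) i = bfloor (\<alpha> i u)) \<and>
    (\<forall>i<l. \<forall>v\<in>V - V0. cdeg U (\<lambda>u. g u v) i = bfloor (\<beta> i v)) \<and>
    (\<forall>i<l. (\<Sum>u\<in>U - U0. cdeg (V - V0) (g u) i) = 0 \<or> (\<Sum>u\<in>U - U0. cdeg (V - V0) (g u) i) > T)"
proof -
  obtain g where g: "fits l U V \<alpha> \<beta> g"
    and least: "\<forall>h. fits l U V \<alpha> \<beta> h \<longrightarrow> weight l U V g \<le> weight l U V h"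
    using ex_has_least_nat[of "fits l U V \<alpha> \<beta>" f "weight l U V"] fit by blast
  have min: "minimal l U V \<alpha> \<beta> g" using fin g least by (auto simp: minimal_def)
  define A where "A i = {u \<in> U. bfloor (\<alpha> i u) < cdeg V (g u) i}" for i
  define A' where "A' i = {v \<in> V. bfloor (\<beta> i v) < cdeg U (\<lambda>u. g u v) i}" for i
  let ?K = "2 * l * B * B + 2 * l * B + 1"
  have A: "card (\<Union>i<l. A i) \<le> l * ?K"
  proof -
    have "card (\<Union>i<l. A i) \<le> (\<Sum>i<l. card (A i))" by (intro card_UN_le) simp
    also have "\<dots> \<le> (\<Sum>i<l. ?K)"
      unfolding A_def using card_excess_le[OF minimal_flip[OF min], of B] \<alpha>B \<beta>B
      by (intro sum_mono) simp
    finally show ?thesis by simp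
  qed
  have A': "card (\<Union>i<l. A' i) \<le> l * ?K"
  proof -
    have "card (\<Union>i<l. A' i) \<le> (\<Sum>i<l. card (A' i))" by (intro card_UN_le) simp
    also have "\<dots> \<le> (\<Sum>i<l. ?K)"
      unfolding A'_def using card_excess_le[OF min, of B] \<alpha>B \<beta>B
      by (intro sum_mono) simp
    finally show ?thesis by simp
  qed
  let ?V0 = "\<Union>i<l. A' i"
  have "(\<Union>i<l. A i) \<subseteq> U" by (auto simp: A_def)
  from remove_small_types[OF fin(1) _ this, of "V - ?V0" l T g] fin
  obtain U1 where U1: "(\<Union>i<l. A i) \<subseteq> U1" "U1 \<subseteq> U" "card U1 \<le> card (\<Union>i<l. A i) + l * T"
    "\<forall>i<l. (\<Sum>u\<in>U - U1. cdeg (V - ?V0) (g u) i) = 0 \<or> (\<Sum>u\<in>U - U1. cdeg (V - ?V0) (g u) i) > T"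
    by auto
  have "cdeg V (g u) i = bfloor (\<alpha> i u)" if "i < l" "u \<in> U - U1" for i u
  proof (rule antisym)
    show "cdeg V (g u) i \<le> bfloor (\<alpha> i u)" using that U1(1) by (force simp: A_def)
    show "bfloor (\<alpha> i u) \<le> cdeg V (g u) i"
      using that g by (intro bfloor_le_meets) (auto simp: fits_def)
  qed
  moreover have "cdeg U (\<lambda>u. g u v) i = bfloor (\<beta> i v)" if "i < l" "v \<in> V - ?V0" for i v
  proof (rule antisym)
    show "cdeg U (\<lambda>u. g u v) i \<le> bfloor (\<beta> i v)" using that by (force simp: A'_def)
    show "bfloor (\<beta> i v) \<le> cdeg U (\<lambda>u. g u v) i"
      using that g by (intro bfloor_le_meets) (auto simp: fits_def)
  qed
  moreover have "?V0 \<subseteq> V" by (auto simp: A'_def)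
  moreover have "card U1 \<le> l * ?K + l * T" "card ?V0 \<le> l * ?K + l * T"
    using U1(3) A A' by linarith+
  ultimately show ?thesis using g U1(2,4)
    by (intro exI[of _ g] exI[of _ U1] exI[of _ ?V0]) simp
qed

section \<open>Graphs and colourings\<close>

definition coloured :: "nat \<Rightarrow> nat \<Rightarrow> nat \<Rightarrow> bnum mat \<Rightarrow> bnum mat \<Rightarrow> (nat \<Rightarrow> nat) \<Rightarrow> (nat \<Rightarrow> nat)
    \<Rightarrow> 'a set \<Rightarrow> 'b set \<Rightarrow> ('a \<Rightarrow> nat) \<Rightarrow> ('b \<Rightarrow> nat) \<Rightarrow> ('a \<Rightarrow> 'b \<Rightarrow> nat) \<Rightarrow> bool" where
  "coloured l m n C D X Y U V c d f \<longleftrightarrow> finite U \<and> finite V \<and> c ` U \<subseteq> {..<m} \<and> d ` V \<subseteq> {..<n} \<and>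
     (\<forall>j<m. cdeg U c j = X j) \<and> (\<forall>j<n. cdeg V d j = Y j) \<and>
     fits l U V (\<lambda>i u. C $$ (i, c u)) (\<lambda>i v. D $$ (i, d v)) f"

text \<open>Disjointness of the sides excludes edges with \<open>u\<close> as second component,
  which \<open>deg\<close> would count too.\<close>

lemma deg_left:
  assumes "U \<inter> V = {}" "F \<subseteq> U \<times> V" "u \<in> U"
  shows "deg F u = card {v \<in> V. (u, v) \<in> F}"
proof -
  have "{e \<in> F. fst e = u \<or> snd e = u} = Pair u ` {v \<in> V. (u, v) \<in> F}"
    using assms by (auto simp: image_iff)
  then show ?thesis unfolding deg_def by (simp add: card_image inj_on_def)
qed

lemma deg_right:
  assumes "U \<inter> V = {}" "F \<subseteq> U \<times> V" "v \<in> V"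
  shows "deg F v = card {u \<in> U. (u, v) \<in> F}"
proof -
  have "{e \<in> F. fst e = v \<or> snd e = v} = (\<lambda>u. (u, v)) ` {u \<in> U. (u, v) \<in> F}"
    using assms by (auto simp: image_iff)
  then show ?thesis unfolding deg_def by (simp add: card_image inj_on_def)
qed

lemma partition_column:
  assumes "partition_of_size W S P"
  shows "\<exists>c. c ` W \<subseteq> {..<dim_vec S} \<and> (\<forall>j<dim_vec S. P j = {w \<in> W. c w = j})"
proof -
  let ?c = "\<lambda>w. SOME j. j < dim_vec S \<and> w \<in> P j"
  have c: "?c w < dim_vec S \<and> w \<in> P (?c w)" if "w \<in> W" for w
  proof -
    have "\<exists>j. j < dim_vec S \<and> w \<in> P j" using that assms by (auto simp: partition_of_size_def)
    then show ?thesis by (rule someI_ex)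
  qed
  have uniq: "j = j'" if "j < dim_vec S" "j' < dim_vec S" "w \<in> P j" "w \<in> P j'" for w j j'
    using that assms unfolding partition_of_size_def by blast
  have sub: "P j \<subseteq> W" if "j < dim_vec S" for j
    using that assms by (auto simp: partition_of_size_def)
  have "P j = {w \<in> W. ?c w = j}" if "j < dim_vec S" for j
    using c uniq[OF _ that] sub[OF that] that by blast
  then show ?thesis using c by (intro exI[of _ ?c]) auto
qed

lemma biregular_imp_coloured:
  assumes C: "C \<in> carrier_mat l m" and M: "M \<in> carrier_vec m" and N: "N \<in> carrier_vec n"
    and bi: "biregular C D M N U V E"
  shows "\<exists>c d f. coloured l m n C D (($) M) (($) N) U V c d f"
proof -
  have dims: "dim_row C = l" "dim_vec M = m" "dim_vec N = n" using C M N by auto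
  obtain P Q where P: "partition_of_size U M P" and Q: "partition_of_size V N Q"
    and rows: "\<forall>i<l. \<forall>j<m. \<forall>u\<in>P j. meets (deg (E i) u) (C $$ (i, j))"
    and cols: "\<forall>i<l. \<forall>j<n. \<forall>v\<in>Q j. meets (deg (E i) v) (D $$ (i, j))"
    using bi dims by (auto simp: biregular_def)
  have disj: "U \<inter> V = {}" and E: "\<And>i. i < l \<Longrightarrow> E i \<subseteq> U \<times> V"
    and EE: "\<And>i i'. i < l \<Longrightarrow> i' < l \<Longrightarrow> i \<noteq> i' \<Longrightarrow> E i \<inter> E i' = {}"
    using bi dims by (auto simp: biregular_def bipartite_graph_def)
  obtain c where c: "c ` U \<subseteq> {..<m}" "\<And>j. j < m \<Longrightarrow> P j = {u \<in> U. c u = j}"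
    using partition_column[OF P] dims by auto
  obtain d where d: "d ` V \<subseteq> {..<n}" "\<And>j. j < n \<Longrightarrow> Q j = {v \<in> V. d v = j}"
    using partition_column[OF Q] dims by auto
  \<comment> \<open>Disjointness of the edge sets makes the chosen type unique, whence
    \<open>f_iff\<close>.\<close>
  define f where "f u v = (if \<exists>i<l. (u, v) \<in> E i then SOME i. i < l \<and> (u, v) \<in> E i else l)" for u v
  have f_edge: "f u v < l \<and> (u, v) \<in> E (f u v)" if "\<exists>i<l. (u, v) \<in> E i" for u v
  proof -
    have "f u v = (SOME i. i < l \<and> (u, v) \<in> E i)" using that by (simp add: f_def)
    then show ?thesis using someI_ex[OF that] by simp
  qed
  have f_le: "f u v \<le> l" for u v
    using f_edge[of u v] by (cases "\<exists>i<l. (u, v) \<in> E i") (auto simp: f_def)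
  have f_iff: "f u v = i \<longleftrightarrow> (u, v) \<in> E i" if i: "i < l" for u v i
  proof (cases "\<exists>i<l. (u, v) \<in> E i")
    case True
    then show ?thesis using f_edge[OF True] EE[OF i, of "f u v"] by blast
  qed (use i in \<open>auto simp: f_def\<close>)
  have "cdeg V (f u) i = deg (E i) u" if "i < l" "u \<in> U" for i u
    using deg_left[OF disj E[OF that(1)] that(2)] f_iff[OF that(1)] by (simp add: cdeg_def)
  then have "meets (cdeg V (f u) i) (C $$ (i, c u))" if "i < l" "u \<in> U" for i u
    using that rows c by auto
  moreover have "cdeg U (\<lambda>u. f u v) i = deg (E i) v" if "i < l" "v \<in> V" for i v
    using deg_right[OF disj E[OF that(1)] that(2)] f_iff[OF that(1)] by (simp add: cdeg_def)
  then have "meets (cdeg U (\<lambda>u. f u v) i) (D $$ (i, d v))" if "i < l" "v \<in> V" for i v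
    using that cols d by auto
  ultimately have "fits l U V (\<lambda>i u. C $$ (i, c u)) (\<lambda>i v. D $$ (i, d v)) f"
    using f_le by (auto simp: fits_def)
  moreover have "finite U" "finite V" using P Q by (simp_all add: partition_of_size_def)
  moreover have "\<forall>j<m. cdeg U c j = M $ j" "\<forall>j<n. cdeg V d j = N $ j"
    using P Q c d dims by (auto simp: partition_of_size_def cdeg_def)
  ultimately show ?thesis using c d unfolding coloured_def by blast
qed

lemma coloured_imp_biregular:
  assumes C: "C \<in> carrier_mat l m" and M: "M \<in> carrier_vec m" and N: "N \<in> carrier_vec n"
    and col: "coloured l m n C D (($) M) (($) N) U V c d f"
  shows "\<exists>(U' :: nat set) (V' :: nat set) E. biregular C D M N U' V' E"
proof -
  have dims: "dim_row C = l" "dim_vec M = m" "dim_vec N = n" using C M N by auto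
  have fin: "finite U" "finite V" and c: "c ` U \<subseteq> {..<m}" and d: "d ` V \<subseteq> {..<n}"
    and X: "\<forall>j<m. cdeg U c j = M $ j" and Y: "\<forall>j<n. cdeg V d j = N $ j"
    and fit: "fits l U V (\<lambda>i u. C $$ (i, c u)) (\<lambda>i v. D $$ (i, d v)) f"
    using col by (auto simp: coloured_def)
  obtain h0 :: "_ \<Rightarrow> nat" where h0: "inj_on h0 U" using fin finite_imp_inj_to_nat_seg by metis
  obtain k0 :: "_ \<Rightarrow> nat" where k0: "inj_on k0 V" using fin finite_imp_inj_to_nat_seg by metis
  \<comment> \<open>Even numbers on the left and odd numbers on the right keep the two sides
    disjoint.\<close>
  define h where "h u = 2 * h0 u" for u
  define k where "k v = 2 * k0 v + 1" for v
  have h: "inj_on h U" and k: "inj_on k V" using h0 k0 by (auto simp: h_def k_def inj_on_def)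
  have disj: "h ` U \<inter> k ` V = {}" by (auto simp: h_def k_def) presburger
  define E where "E i = {(h u, k v) | u v. u \<in> U \<and> v \<in> V \<and> f u v = i}" for i
  have E_iff: "(h u, k v) \<in> E i \<longleftrightarrow> f u v = i" if "u \<in> U" "v \<in> V" for u v i
    using that h k by (auto simp: E_def inj_on_def)
  have E_sub: "E i \<subseteq> h ` U \<times> k ` V" for i by (auto simp: E_def)
  have "E i \<inter> E i' = {}" if "i \<noteq> i'" for i i'
    using that E_iff E_sub by fastforce
  then have graph: "bipartite_graph l (h ` U) (k ` V) E"
    using disj E_sub by (auto simp: bipartite_graph_def)
  have degU: "deg (E i) (h u) = cdeg V (f u) i" if "u \<in> U" for i u
  proof -
    have "{w \<in> k ` V. (h u, w) \<in> E i} = k ` {v \<in> V. f u v = i}" using E_iff that by auto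
    then show ?thesis using deg_left[OF disj E_sub, of "h u" i] that k
      by (auto simp: cdeg_def card_image inj_on_def)
  qed
  have degV: "deg (E i) (k v) = cdeg U (\<lambda>u. f u v) i" if "v \<in> V" for i v
  proof -
    have "{w \<in> h ` U. (w, k v) \<in> E i} = h ` {u \<in> U. f u v = i}" using E_iff that by auto
    then show ?thesis using deg_right[OF disj E_sub, of "k v" i] that h
      by (auto simp: cdeg_def card_image inj_on_def)
  qed
  let ?P = "\<lambda>j. h ` {u \<in> U. c u = j}" and ?Q = "\<lambda>j. k ` {v \<in> V. d v = j}"
  have "card (?P j) = cdeg U c j" for j
    using h unfolding cdeg_def by (intro card_image) (auto simp: inj_on_def)
  then have "partition_of_size (h ` U) M ?P"
    using c X fin h by (auto simp: partition_of_size_def dims inj_on_def)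
  moreover have "card (?Q j) = cdeg V d j" for j
    using k unfolding cdeg_def by (intro card_image) (auto simp: inj_on_def)
  then have "partition_of_size (k ` V) N ?Q"
    using d Y fin k by (auto simp: partition_of_size_def dims inj_on_def)
  moreover have "\<forall>i<l. \<forall>j<m. \<forall>u\<in>?P j. meets (deg (E i) u) (C $$ (i, j))"
    using fit degU by (auto simp: fits_def)
  moreover have "\<forall>i<l. \<forall>j<n. \<forall>v\<in>?Q j. meets (deg (E i) v) (D $$ (i, j))"
    using fit degV by (auto simp: fits_def)
  ultimately have "biregular C D M N (h ` U) (k ` V) E"
    unfolding biregular_def dims using graph by blast
  then show ?thesis by blast
qed

section \<open>Counting vertices by type\<close>

text \<open>
  The exceptional vertices are numbered \<open>a < p\<close> on the left and \<open>b < q\<close> on the right. A remaining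
  left vertex of column \<open>j\<close> has the type \<open>(j, \<tau>)\<close>, where \<open>\<tau> b\<close> is the colour of its edge to \<open>b\<close>.
\<close>

definition types :: "nat \<Rightarrow> nat \<Rightarrow> nat \<Rightarrow> bnum mat \<Rightarrow> (nat \<times> (nat \<Rightarrow> nat)) set" where
  "types l m q C = {(j, \<tau>). j < m \<and> \<tau> \<in> {..<q} \<rightarrow>\<^sub>E {..l} \<and>
     (\<forall>i<l. cdeg {..<q} \<tau> i \<le> bfloor (C $$ (i, j)))}"

text \<open>The conditions for one side: column sizes, and degrees of its exceptional vertices. Here
  \<open>x\<close> and \<open>y\<close> give the number of remaining vertices of each type on this
  and on the opposite side, and \<open>S\<close> holds the opposite types. The other side is the
  instance with \<open>g\<close> transposed.\<close>

definition side :: "nat \<Rightarrow> nat \<Rightarrow> nat \<Rightarrow> (nat \<Rightarrow> nat) \<Rightarrow> nat \<Rightarrow> bnum mat \<Rightarrow> (nat \<Rightarrow> nat \<Rightarrow> nat)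
    \<Rightarrow> (nat \<times> (nat \<Rightarrow> nat)) set \<Rightarrow> (nat \<times> (nat \<Rightarrow> nat) \<Rightarrow> nat) \<Rightarrow> (nat \<times> (nat \<Rightarrow> nat) \<Rightarrow> nat)
    \<Rightarrow> (nat \<Rightarrow> nat) \<Rightarrow> bool" where
  "side l m p c q C g S x y X \<longleftrightarrow>
     (\<forall>j<m. cdeg {..<p} c j + (\<Sum>t\<in>types l m q C. x t * of_bool (fst t = j)) = X j) \<and>
     (\<forall>i<l. \<forall>a<p. meets (cdeg {..<q} (g a) i + (\<Sum>s\<in>S. y s * of_bool (snd s a = i))) (C $$ (i, c a)))"

text \<open>The number of edges of type \<open>i\<close> that the remaining vertices of this side
  still need among the remaining vertices opposite. For \<open>i < l\<close> the bound in
  \<open>types\<close> prevents the subtraction from being truncated.\<close>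

definition residual :: "nat \<Rightarrow> nat \<Rightarrow> nat \<Rightarrow> bnum mat \<Rightarrow> (nat \<times> (nat \<Rightarrow> nat) \<Rightarrow> nat) \<Rightarrow> nat \<Rightarrow> nat" where
  "residual l m q C x i =
     (\<Sum>t\<in>types l m q C. x t * (bfloor (C $$ (i, fst t)) - cdeg {..<q} (snd t) i))"

definition counts :: "nat \<Rightarrow> nat \<Rightarrow> nat \<Rightarrow> bnum mat \<Rightarrow> bnum mat \<Rightarrow> nat
    \<Rightarrow> nat \<Rightarrow> (nat \<Rightarrow> nat) \<Rightarrow> nat \<Rightarrow> (nat \<Rightarrow> nat) \<Rightarrow> (nat \<Rightarrow> nat \<Rightarrow> nat) \<Rightarrow> (nat \<Rightarrow> nat) \<Rightarrow> (nat \<Rightarrow> nat)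
    \<Rightarrow> (nat \<times> (nat \<Rightarrow> nat) \<Rightarrow> nat) \<Rightarrow> (nat \<times> (nat \<Rightarrow> nat) \<Rightarrow> nat) \<Rightarrow> bool" where
  "counts l m n C D T p c q d g X Y x y \<longleftrightarrow>
     side l m p c q C g (types l n p D) x y X \<and>
     side l n q d p D (\<lambda>b a. g a b) (types l m q C) y x Y \<and>
     (\<forall>i<l. residual l m q C x i = residual l n p D y i \<and>
       (residual l m q C x i = 0 \<or> T < residual l m q C x i))"

lemma finite_types: "finite (types l m q C)"
proof (rule finite_subset)
  show "types l m q C \<subseteq> {..<m} \<times> ({..<q} \<rightarrow>\<^sub>E {..l})" by (auto simp: types_def)
  show "finite ({..<m} \<times> ({..<q} \<rightarrow>\<^sub>E {..l}))" by (intro finite_cartesian_product finite_PiE) auto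
qed

section \<open>Counting in disjoint unions, under bijections and by type\<close>

lemma cdeg_Plus:
  assumes "finite A" "finite B"
  shows "cdeg (A <+> B) h i = cdeg A (\<lambda>a. h (Inl a)) i + cdeg B (\<lambda>b. h (Inr b)) i"
proof -
  have "{w \<in> A <+> B. h w = i} = {a \<in> A. h (Inl a) = i} <+> {b \<in> B. h (Inr b) = i}" by auto
  then show ?thesis using assms by (simp add: cdeg_def card_Plus)
qed

lemma cdeg_Sigma:
  assumes "finite S"
  shows "cdeg (SIGMA t:S. {..<x t}) (\<lambda>s. h (fst s)) i = (\<Sum>t\<in>S. x t * of_bool (h t = i))"
proof -
  have "{s \<in> (SIGMA t:S. {..<x t}). h (fst s) = i} = (SIGMA t:S. {k. k < x t \<and> h t = i})" by auto
  moreover have "card {k. k < x t \<and> h t = i} = x t * of_bool (h t = i)" for t by simp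
  ultimately show ?thesis using assms unfolding cdeg_def by simp
qed

text \<open>Colours above \<open>l\<close> are turned into the value for no edge, so edge types keep
  their degrees.\<close>

lemma cdeg_min: "i < l \<Longrightarrow> cdeg W (\<lambda>w. min l (h w)) i = cdeg W h i"
  unfolding cdeg_def by (rule arg_cong[where f = card]) auto

lemma cdeg_Un:
  assumes "finite W" "W0 \<subseteq> W"
  shows "cdeg W h i = cdeg W0 h i + cdeg (W - W0) h i"
proof -
  have "{w \<in> W. h w = i} = {w \<in> W0. h w = i} \<union> {w \<in> W - W0. h w = i}" using assms by auto
  then show ?thesis using assms finite_subset[OF assms(2,1)] unfolding cdeg_def
    by (simp add: card_Un_disjoint disjoint_iff)
qed

lemma cdeg_reindex:
  assumes "bij_betw \<gamma> A W"
  shows "cdeg W h i = cdeg A (\<lambda>a. h (\<gamma> a)) i"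
proof -
  have "{w \<in> W. h w = i} = \<gamma> ` {a \<in> A. h (\<gamma> a) = i}" using assms by (auto simp: bij_betw_def)
  then show ?thesis using assms unfolding cdeg_def
    by (auto simp: bij_betw_def inj_on_def intro!: card_image)
qed

lemma sum_by_type:
  fixes G :: "'t \<Rightarrow> nat"
  assumes "finite W" "finite S" "ty ` W \<subseteq> S"
  shows "(\<Sum>t\<in>S. card {w \<in> W. ty w = t} * G t) = (\<Sum>w\<in>W. G (ty w))"
proof -
  have "(\<Sum>t\<in>S. card {w \<in> W. ty w = t} * G t) = (\<Sum>t\<in>S. \<Sum>w\<in>{w \<in> W. ty w = t}. G (ty w))"
    by (intro sum.cong) auto
  also have "\<dots> = (\<Sum>w\<in>W. G (ty w))" by (rule sum.group[OF assms])
  finally show ?thesis .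
qed

text \<open>\<open>Inl a\<close> is an exceptional vertex and \<open>Inr (t, k)\<close> the
  \<open>k\<close>-th vertex of type \<open>t\<close>. Exceptional vertices meet their constraints
  by \<open>side\<close>; at any other vertex the edges to exceptional vertices and the exact
  remainder add up to the floor.\<close>

lemma side_sound:
  fixes F :: "nat + (nat \<times> (nat \<Rightarrow> nat)) \<times> nat \<Rightarrow> nat + (nat \<times> (nat \<Rightarrow> nat)) \<times> nat \<Rightarrow> nat"
  defines "A \<equiv> \<lambda>l m q C x. SIGMA t:types l m q C. {..<x t :: nat}"
    and "cl \<equiv> \<lambda>c. case_sum c (\<lambda>s. fst (fst s))"
  assumes side: "side l m p c q C g S x y X" and S: "finite S" and c: "\<forall>a<p. c a < m"
    and F: "\<And>a b. F (Inl a) (Inl b) = g a b" "\<And>a s. F (Inl a) (Inr s) = snd (fst s) a"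
      "\<And>s b. F (Inr s) (Inl b) = snd (fst s) b"
    and exact: "\<forall>i<l. \<forall>s\<in>A l m q C x.
      cdeg (SIGMA t:S. {..<y t}) (\<lambda>r. F (Inr s) (Inr r)) i
        = bfloor (C $$ (i, fst (fst s))) - cdeg {..<q} (snd (fst s)) i"
  shows "cl c ` ({..<p} <+> A l m q C x) \<subseteq> {..<m}"
    and "\<forall>j<m. cdeg ({..<p} <+> A l m q C x) (cl c) j = X j"
    and "\<forall>i<l. \<forall>u\<in>{..<p} <+> A l m q C x.
      meets (cdeg ({..<q} <+> (SIGMA t:S. {..<y t})) (F u) i) (C $$ (i, cl c u))"
proof -
  show "cl c ` ({..<p} <+> A l m q C x) \<subseteq> {..<m}"
    using c by (auto simp: cl_def A_def types_def)
  have fin: "finite (A l m q C x)" "finite (SIGMA t:S. {..<y t})"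
    using S by (auto simp: A_def finite_types)
  show "\<forall>j<m. cdeg ({..<p} <+> A l m q C x) (cl c) j = X j"
    using side fin cdeg_Sigma[OF finite_types, of l m q C x fst]
    by (simp add: cdeg_Plus side_def cl_def A_def)
  have "meets (cdeg ({..<q} <+> (SIGMA t:S. {..<y t})) (F u) i) (C $$ (i, cl c u))"
    if i: "i < l" and u: "u \<in> {..<p} <+> A l m q C x" for i u
  proof (cases u)
    case (Inl a)
    then have "a < p" using u by auto
    then show ?thesis
      using Inl side fin i cdeg_Sigma[OF S, of y "\<lambda>t. snd t a" i]
      by (simp add: cdeg_Plus F side_def cl_def)
  next
    case (Inr s)
    then have s: "s \<in> A l m q C x" using u by auto
    then have "cdeg {..<q} (snd (fst s)) i \<le> bfloor (C $$ (i, fst (fst s)))"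
      using i by (auto simp: A_def types_def)
    then show ?thesis
      using Inr fin exact[rule_format, OF i s] by (simp add: cdeg_Plus F cl_def meets_bfloor)
  qed
  then show "\<forall>i<l. \<forall>u\<in>{..<p} <+> A l m q C x.
      meets (cdeg ({..<q} <+> (SIGMA t:S. {..<y t})) (F u) i) (C $$ (i, cl c u))" by blast
qed

lemma sum_residual:
  "(\<Sum>s\<in>(SIGMA t:types l m q C. {..<x t}). bfloor (C $$ (i, fst (fst s))) - cdeg {..<q} (snd (fst s)) i)
    = residual l m q C x i"
proof -
  have "(\<Sum>s\<in>(SIGMA t:types l m q C. {..<x t}). bfloor (C $$ (i, fst (fst s))) - cdeg {..<q} (snd (fst s)) i)
    = (\<Sum>t\<in>types l m q C. \<Sum>k<x t. bfloor (C $$ (i, fst t)) - cdeg {..<q} (snd t) i)"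
    by (subst sum.Sigma) (auto simp: finite_types intro!: sum.cong)
  then show ?thesis by (simp add: residual_def)
qed

text \<open>The colours prescribed at the exceptional vertices are glued to an exact colouring
  \<open>h\<close> of the residual degrees; with this \<open>T\<close>, the residual condition in
  \<open>counts\<close> is the one that \<open>exact_colouring_exists\<close> requires.\<close>

lemma counts_sound:
  assumes counts: "counts l m n C D T p c q d g X Y x y"
    and c: "\<forall>a<p. c a < m" and d: "\<forall>b<q. d b < n"
    and CB: "\<And>i j. i < l \<Longrightarrow> j < m \<Longrightarrow> bfloor (C $$ (i, j)) \<le> B"
    and DB: "\<And>i j. i < l \<Longrightarrow> j < n \<Longrightarrow> bfloor (D $$ (i, j)) \<le> B"
    and T: "T = 3 * l * B * B"
  shows "\<exists>(U :: (nat + (nat \<times> (nat \<Rightarrow> nat)) \<times> nat) set) (V :: (nat + (nat \<times> (nat \<Rightarrow> nat)) \<times> nat) set) c' d' f.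
    coloured l m n C D X Y U V c' d' f"
proof -
  define A where "A = (SIGMA t:types l m q C. {..<x t})"
  define A' where "A' = (SIGMA t:types l n p D. {..<y t})"
  define \<alpha> where "\<alpha> i s = bfloor (C $$ (i, fst (fst s))) - cdeg {..<q} (snd (fst s)) i"
    for i and s :: "(nat \<times> (nat \<Rightarrow> nat)) \<times> nat"
  define \<beta> where "\<beta> i s = bfloor (D $$ (i, fst (fst s))) - cdeg {..<p} (snd (fst s)) i"
    for i and s :: "(nat \<times> (nat \<Rightarrow> nat)) \<times> nat"
  have fin: "finite A" "finite A'" by (auto simp: A_def A'_def finite_types)
  have sums: "(\<Sum>s\<in>A. \<alpha> i s) = residual l m q C x i" "(\<Sum>s\<in>A'. \<beta> i s) = residual l n p D y i" for i
    unfolding A_def A'_def \<alpha>_def \<beta>_def by (rule sum_residual)+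
  have "\<alpha> i s \<le> B" if "i < l" "s \<in> A" for i s
    using that CB[of i "fst (fst s)"] by (force simp: \<alpha>_def A_def types_def intro: le_trans[OF diff_le_self])
  moreover have "\<beta> i s \<le> B" if "i < l" "s \<in> A'" for i s
    using that DB[of i "fst (fst s)"] by (force simp: \<beta>_def A'_def types_def intro: le_trans[OF diff_le_self])
  ultimately obtain h where h: "\<forall>i<l. \<forall>u\<in>A. cdeg A' (h u) i = \<alpha> i u"
    "\<forall>i<l. \<forall>v\<in>A'. cdeg A (\<lambda>u. h u v) i = \<beta> i v"
    using exact_colouring_exists[OF fin, of l \<alpha> B \<beta>] counts unfolding sums counts_def T by blast
  define F where "F u v = (case u of
      Inl a \<Rightarrow> (case v of Inl b \<Rightarrow> g a b | Inr s \<Rightarrow> snd (fst s) a)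
    | Inr s \<Rightarrow> (case v of Inl b \<Rightarrow> snd (fst s) b | Inr r \<Rightarrow> h s r))" for u v
  have left: "side l m p c q C g (types l n p D) x y X"
    and right: "side l n q d p D (\<lambda>b a. g a b) (types l m q C) y x Y"
    using counts by (auto simp: counts_def)
  have F: "F (Inl a) (Inl b) = g a b" "F (Inl a) (Inr s) = snd (fst s) a"
    "F (Inr s) (Inl b) = snd (fst s) b" "F (Inr s) (Inr r) = h s r" for a b s r
    by (simp_all add: F_def)
  have exL: "\<forall>i<l. \<forall>s\<in>A. cdeg A' (\<lambda>r. F (Inr s) (Inr r)) i
      = bfloor (C $$ (i, fst (fst s))) - cdeg {..<q} (snd (fst s)) i"
    and exR: "\<forall>i<l. \<forall>r\<in>A'. cdeg A (\<lambda>s. F (Inr s) (Inr r)) i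
      = bfloor (D $$ (i, fst (fst r))) - cdeg {..<p} (snd (fst r)) i"
    unfolding F(4) using h by (auto simp: \<alpha>_def \<beta>_def)
  note L = side_sound[of l m p c q C g _ x y X F,
      OF left finite_types c F(1,2,3) exL[unfolded A_def A'_def], folded A_def A'_def]
  note R = side_sound[of l n q d p D _ _ y x Y "\<lambda>v u. F u v",
      OF right finite_types d F(1,3,2) exR[unfolded A_def A'_def], folded A_def A'_def]
  let ?U = "{..<p} <+> A" and ?V = "{..<q} <+> A'"
  let ?c = "case_sum c (\<lambda>s. fst (fst s))" and ?d = "case_sum d (\<lambda>s. fst (fst s))"
  \<comment> \<open>\<open>F\<close> may take values above \<open>l\<close>, for instance through
    \<open>g\<close>; \<open>min l\<close> provides the global bound in \<open>fits\<close>.\<close>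
  have "fits l ?U ?V (\<lambda>i u. C $$ (i, ?c u)) (\<lambda>i v. D $$ (i, ?d v)) (\<lambda>u v. min l (F u v))"
    using L(3) R(3) by (simp add: fits_def cdeg_min)
  then have "coloured l m n C D X Y ?U ?V ?c ?d (\<lambda>u v. min l (F u v))"
    unfolding coloured_def using L(1,2) R(1,2) fin by simp
  then show ?thesis by blast
qed

text \<open>Converse to \<open>side_sound\<close>: degrees are split at \<open>V0\<close>, and sums
  over vertices are regrouped by type. By tightness, the residual counts the edges of type
  \<open>i\<close> outside the exceptional sets.\<close>

lemma side_complete:
  assumes fin: "finite U" "finite V" and U0: "U0 \<subseteq> U" and V0: "V0 \<subseteq> V"
    and \<gamma>: "bij_betw \<gamma> {..<p} U0" and \<delta>: "bij_betw \<delta> {..<q} V0"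
    and c: "c ` U \<subseteq> {..<m}" and f: "\<forall>u v. f u v \<le> l"
    and fit: "\<forall>i<l. \<forall>u\<in>U. meets (cdeg V (f u) i) (C $$ (i, c u))"
    and tight: "\<forall>i<l. \<forall>u\<in>U - U0. cdeg V (f u) i = bfloor (C $$ (i, c u))"
    and c0: "\<forall>a<p. c0 a = c (\<gamma> a)"
    and g: "\<forall>a<p. \<forall>b<q. g a b = f (\<gamma> a) (\<delta> b)"
    and ty: "ty = (\<lambda>u. (c u, \<lambda>b\<in>{..<q}. f u (\<delta> b)))"
    and x: "x = (\<lambda>t. card {u \<in> U - U0. ty u = t})"
    and S: "finite S" "ty' ` (V - V0) \<subseteq> S"
    and ty': "\<forall>v. \<forall>a<p. snd (ty' v) a = f (\<gamma> a) v"
    and y: "y = (\<lambda>s. card {v \<in> V - V0. ty' v = s})"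
  shows "ty ` (U - U0) \<subseteq> types l m q C"
    and "side l m p c0 q C g S x y (cdeg U c)"
    and "\<forall>i<l. residual l m q C x i = (\<Sum>u\<in>U - U0. cdeg (V - V0) (f u) i)"
proof -
  have row: "cdeg V (f u) i = cdeg {..<q} (\<lambda>b. f u (\<delta> b)) i + cdeg (V - V0) (f u) i" for u i
    using cdeg_Un[OF fin(2) V0] cdeg_reindex[OF \<delta>] by metis
  have res: "cdeg {..<q} (\<lambda>b\<in>{..<q}. f u (\<delta> b)) i = cdeg {..<q} (\<lambda>b. f u (\<delta> b)) i" for u i
    by (rule cdeg_cong) simp
  show tys: "ty ` (U - U0) \<subseteq> types l m q C"
  proof (rule image_subsetI)
    fix u assume u: "u \<in> U - U0"
    have "cdeg {..<q} (\<lambda>b\<in>{..<q}. f u (\<delta> b)) i \<le> bfloor (C $$ (i, c u))" if "i < l" for i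
      using tight[rule_format, OF that u] row[of u i] res by simp
    then show "ty u \<in> types l m q C" using u c f by (auto simp: ty types_def)
  qed
  have finU: "finite (U - U0)" "finite (V - V0)" using fin by auto
  have "cdeg {..<p} c0 j + (\<Sum>t\<in>types l m q C. x t * of_bool (fst t = j)) = cdeg U c j" for j
  proof -
    have "(\<Sum>t\<in>types l m q C. x t * of_bool (fst t = j)) = (\<Sum>u\<in>U - U0. of_bool (fst (ty u) = j))"
      unfolding x by (rule sum_by_type[OF finU(1) finite_types tys])
    also have "\<dots> = cdeg (U - U0) c j" using finU by (simp only: cdeg_eq_sum ty fst_conv)
    finally show ?thesis
      using cdeg_Un[OF fin(1) U0, of c j] cdeg_reindex[OF \<gamma>, of c j]
        cdeg_cong[of "{..<p}" c0 "\<lambda>a. c (\<gamma> a)" j] c0 by simp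
  qed
  moreover have "meets (cdeg {..<q} (g a) i + (\<Sum>s\<in>S. y s * of_bool (snd s a = i))) (C $$ (i, c0 a))"
    if "i < l" "a < p" for i a
  proof -
    have u: "\<gamma> a \<in> U" using \<gamma> U0 that by (auto simp: bij_betw_def)
    have "(\<Sum>s\<in>S. y s * of_bool (snd s a = i)) = (\<Sum>v\<in>V - V0. of_bool (snd (ty' v) a = i))"
      unfolding y by (rule sum_by_type[OF finU(2) S])
    also have "\<dots> = (\<Sum>v\<in>V - V0. of_bool (f (\<gamma> a) v = i))"
      using ty' that by (intro sum.cong) auto
    also have "\<dots> = cdeg (V - V0) (f (\<gamma> a)) i" using finU by (simp only: cdeg_eq_sum)
    finally have "cdeg {..<q} (g a) i + (\<Sum>s\<in>S. y s * of_bool (snd s a = i)) = cdeg V (f (\<gamma> a)) i"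
      using row[of "\<gamma> a" i] cdeg_cong[of "{..<q}" "g a" "\<lambda>b. f (\<gamma> a) (\<delta> b)" i] g that by simp
    then show ?thesis using fit[rule_format, OF that(1) u] c0 that by simp
  qed
  ultimately show "side l m p c0 q C g S x y (cdeg U c)" by (simp add: side_def)
  show "\<forall>i<l. residual l m q C x i = (\<Sum>u\<in>U - U0. cdeg (V - V0) (f u) i)"
  proof (intro allI impI)
    fix i assume i: "i < l"
    have "residual l m q C x i
      = (\<Sum>u\<in>U - U0. bfloor (C $$ (i, fst (ty u))) - cdeg {..<q} (snd (ty u)) i)"
      unfolding x residual_def by (rule sum_by_type[OF finU(1) finite_types tys])
    also have "\<dots> = (\<Sum>u\<in>U - U0. cdeg (V - V0) (f u) i)"
    proof (intro sum.cong refl)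
      fix u assume u: "u \<in> U - U0"
      show "bfloor (C $$ (i, fst (ty u))) - cdeg {..<q} (snd (ty u)) i = cdeg (V - V0) (f u) i"
        using tight[rule_format, OF i u, symmetric] row[of u i] res[of u i] by (simp add: ty)
    qed
    finally show "residual l m q C x i = (\<Sum>u\<in>U - U0. cdeg (V - V0) (f u) i)" .
  qed
qed

lemma counts_complete:
  fixes U V :: "nat set"
  assumes col: "coloured l m n C D X Y U V c d f"
    and CB: "\<And>i j. i < l \<Longrightarrow> j < m \<Longrightarrow> bfloor (C $$ (i, j)) \<le> B"
    and DB: "\<And>i j. i < l \<Longrightarrow> j < n \<Longrightarrow> bfloor (D $$ (i, j)) \<le> B"
    and K: "K = l * (2 * l * B * B + 2 * l * B + 1) + l * T"
  shows "\<exists>p\<le>K. \<exists>q\<le>K. \<exists>c0\<in>{..<p} \<rightarrow>\<^sub>E {..<m}. \<exists>d0\<in>{..<q} \<rightarrow>\<^sub>E {..<n}.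
    \<exists>g\<in>{..<p} \<rightarrow>\<^sub>E {..<q} \<rightarrow>\<^sub>E {..l}. \<exists>x y. counts l m n C D T p c0 q d0 g X Y x y"
proof -
  have fin: "finite U" "finite V" and c: "c ` U \<subseteq> {..<m}" and d: "d ` V \<subseteq> {..<n}"
    and X: "\<forall>j<m. cdeg U c j = X j" and Y: "\<forall>j<n. cdeg V d j = Y j"
    and fit: "fits l U V (\<lambda>i u. C $$ (i, c u)) (\<lambda>i v. D $$ (i, d v)) f"
    using col by (auto simp: coloured_def)
  obtain f' U0 V0 where f': "fits l U V (\<lambda>i u. C $$ (i, c u)) (\<lambda>i v. D $$ (i, d v)) f'"
    and U0: "U0 \<subseteq> U" "card U0 \<le> K" and V0: "V0 \<subseteq> V" "card V0 \<le> K"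
    and tightU: "\<forall>i<l. \<forall>u\<in>U - U0. cdeg V (f' u) i = bfloor (C $$ (i, c u))"
    and tightV: "\<forall>i<l. \<forall>v\<in>V - V0. cdeg U (\<lambda>u. f' u v) i = bfloor (D $$ (i, d v))"
    and large: "\<forall>i<l. (\<Sum>u\<in>U - U0. cdeg (V - V0) (f' u) i) = 0 \<or>
      (\<Sum>u\<in>U - U0. cdeg (V - V0) (f' u) i) > T"
    using normal_form[OF fin fit, of B T] CB DB c d unfolding K by (auto simp: image_subset_iff)
  define p where "p = card U0"
  define q where "q = card V0"
  have fin0: "finite U0" "finite V0" using U0 V0 fin finite_subset by auto
  obtain \<gamma> where \<gamma>: "bij_betw \<gamma> {..<p} U0"
    using ex_bij_betw_nat_finite[OF fin0(1)] by (auto simp: p_def atLeast0LessThan)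
  obtain \<delta> where \<delta>: "bij_betw \<delta> {..<q} V0"
    using ex_bij_betw_nat_finite[OF fin0(2)] by (auto simp: q_def atLeast0LessThan)
  \<comment> \<open>Restriction to the index ranges puts \<open>c0\<close>, \<open>d0\<close> and
    \<open>g\<close> into finite function spaces, over which a formula can form a
    disjunction.\<close>
  define c0 where "c0 = (\<lambda>a\<in>{..<p}. c (\<gamma> a))"
  define d0 where "d0 = (\<lambda>b\<in>{..<q}. d (\<delta> b))"
  define g where "g = (\<lambda>a\<in>{..<p}. \<lambda>b\<in>{..<q}. f' (\<gamma> a) (\<delta> b))"
  define ty where "ty = (\<lambda>u. (c u, \<lambda>b\<in>{..<q}. f' u (\<delta> b)))"
  define ty' where "ty' = (\<lambda>v. (d v, \<lambda>a\<in>{..<p}. f' (\<gamma> a) v))"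
  define x where "x = (\<lambda>t. card {u \<in> U - U0. ty u = t})"
  define y where "y = (\<lambda>s. card {v \<in> V - V0. ty' v = s})"
  have le_l: "\<forall>u v. f' u v \<le> l" "\<forall>v u. f' u v \<le> l"
    and rowU: "\<forall>i<l. \<forall>u\<in>U. meets (cdeg V (f' u) i) (C $$ (i, c u))"
    and rowV: "\<forall>i<l. \<forall>v\<in>V. meets (cdeg U (\<lambda>u. f' u v) i) (D $$ (i, d v))"
    using f' by (auto simp: fits_def)
  have c0: "\<forall>a<p. c0 a = c (\<gamma> a)" and d0: "\<forall>b<q. d0 b = d (\<delta> b)"
    and g: "\<forall>a<p. \<forall>b<q. g a b = f' (\<gamma> a) (\<delta> b)" "\<forall>b<q. \<forall>a<p. g a b = f' (\<gamma> a) (\<delta> b)"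
    and ty_snd: "\<forall>u. \<forall>b<q. snd (ty u) b = f' u (\<delta> b)"
    and ty'_snd: "\<forall>v. \<forall>a<p. snd (ty' v) a = f' (\<gamma> a) v"
    by (auto simp: c0_def d0_def g_def ty_def ty'_def)
  note L = side_complete[OF fin U0(1) V0(1) \<gamma> \<delta> c le_l(1) rowU tightU c0 g(1) ty_def x_def
      _ _ ty'_snd y_def]
  note R = side_complete[OF fin(2,1) V0(1) U0(1) \<delta> \<gamma> d le_l(2) rowV tightV d0 g(2) ty'_def y_def
      _ _ ty_snd x_def]
  \<comment> \<open>Here \<open>S\<close> is the image of the opposite type map itself. This avoids
    a circle, as \<open>S = types l n p D\<close> presupposes \<open>tys'\<close>, and likewise for
    the other side.\<close>
  have tys: "ty ` (U - U0) \<subseteq> types l m q C" using L(1)[OF _ order_refl] fin by simp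
  have tys': "ty' ` (V - V0) \<subseteq> types l n p D" using R(1)[OF _ order_refl] fin by simp
  note L' = L[OF finite_types tys'] and R' = R[OF finite_types tys]
  have "side l m p c0 q C g (types l n p D) x y X"
    using L'(2) X by (simp add: side_def)
  moreover have "side l n q d0 p D (\<lambda>b a. g a b) (types l m q C) y x Y"
    using R'(2) Y by (simp add: side_def)
  moreover have "residual l m q C x i = residual l n p D y i" if "i < l" for i
    using L'(3) R'(3) that cdeg_double_count[of "U - U0" "V - V0" f' i] fin by simp
  moreover have "residual l m q C x i = 0 \<or> T < residual l m q C x i" if "i < l" for i
    using L'(3) large that by simp
  ultimately have "counts l m n C D T p c0 q d0 g X Y x y" by (simp add: counts_def)
  moreover have "c0 \<in> {..<p} \<rightarrow>\<^sub>E {..<m}" "d0 \<in> {..<q} \<rightarrow>\<^sub>E {..<n}"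
    using c d \<gamma> \<delta> U0 V0 by (auto simp: c0_def d0_def bij_betw_def image_subset_iff subset_iff)
  moreover have "g \<in> {..<p} \<rightarrow>\<^sub>E {..<q} \<rightarrow>\<^sub>E {..l}" using le_l by (auto simp: g_def)
  moreover have "p \<le> K" "q \<le> K" using U0 V0 by (auto simp: p_def q_def)
  ultimately show ?thesis by blast
qed

section \<open>Presburger-definable predicates\<close>

text \<open>Definability is stated for functions and predicates of the assignment, so that formulas
  arise from closure rules instead of being written out.\<close>

definition plin :: "nat \<Rightarrow> ((nat \<Rightarrow> nat) \<Rightarrow> nat) \<Rightarrow> bool" where
  "plin k F \<longleftrightarrow> (\<exists>t. vars_pterm t \<subseteq> {..<k} \<and> (\<forall>e. eval_pterm e t = F e))"

definition pdef :: "nat \<Rightarrow> ((nat \<Rightarrow> nat) \<Rightarrow> bool) \<Rightarrow> bool" where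
  "pdef k P \<longleftrightarrow> (\<exists>\<phi>. free_vars \<phi> \<subseteq> {..<k} \<and> (\<forall>e. sat e \<phi> \<longleftrightarrow> P e))"

section \<open>Closure properties of definability\<close>

lemma plin_var: "x < k \<Longrightarrow> plin k (\<lambda>e. e x)"
  unfolding plin_def by (intro exI[of _ "Var x"]) auto

lemma plin_add:
  assumes "plin k F" "plin k G"
  shows "plin k (\<lambda>e. F e + G e)"
proof -
  obtain s t where "vars_pterm s \<subseteq> {..<k}" "\<forall>e. eval_pterm e s = F e"
    "vars_pterm t \<subseteq> {..<k}" "\<forall>e. eval_pterm e t = G e"
    using assms by (auto simp: plin_def)
  then show ?thesis unfolding plin_def by (intro exI[of _ "Add s t"]) auto
qed

lemma plin_zero: "plin k (\<lambda>e. 0)"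
  unfolding plin_def by (intro exI[of _ Zero]) auto

lemma plin_one: "plin k (\<lambda>e. 1)"
  unfolding plin_def by (intro exI[of _ One]) auto

lemma plin_const: "plin k (\<lambda>e. c)"
proof (induction c)
  case (Suc c)
  then show ?case using plin_add[OF Suc plin_one] by simp
qed (rule plin_zero)

lemma plin_mult_const: "plin k F \<Longrightarrow> plin k (\<lambda>e. F e * c)"
proof (induction c)
  case (Suc c)
  then show ?case using plin_add[OF Suc.prems Suc.IH[OF Suc.prems]] by simp
qed (simp add: plin_zero)

lemma plin_sum:
  assumes "finite S" "\<And>s. s \<in> S \<Longrightarrow> plin k (F s)"
  shows "plin k (\<lambda>e. \<Sum>s\<in>S. F s e)"
  using assms
proof (induction S rule: finite_induct)
  case (insert s S)
  then show ?case using plin_add[of k "F s" "\<lambda>e. \<Sum>s\<in>S. F s e"] by simp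
qed (simp add: plin_zero)

lemma pdef_eq:
  assumes "plin k F" "plin k G"
  shows "pdef k (\<lambda>e. F e = G e)"
proof -
  obtain s t where "vars_pterm s \<subseteq> {..<k}" "\<forall>e. eval_pterm e s = F e"
    "vars_pterm t \<subseteq> {..<k}" "\<forall>e. eval_pterm e t = G e"
    using assms by (auto simp: plin_def)
  then show ?thesis unfolding pdef_def by (intro exI[of _ "Eq s t"]) auto
qed

lemma pdef_le:
  assumes "plin k F" "plin k G"
  shows "pdef k (\<lambda>e. F e \<le> G e)"
proof -
  obtain s t where "vars_pterm s \<subseteq> {..<k}" "\<forall>e. eval_pterm e s = F e"
    "vars_pterm t \<subseteq> {..<k}" "\<forall>e. eval_pterm e t = G e"
    using assms by (auto simp: plin_def)
  then show ?thesis unfolding pdef_def by (intro exI[of _ "Le s t"]) auto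
qed

lemma pdef_not:
  assumes "pdef k P"
  shows "pdef k (\<lambda>e. \<not> P e)"
proof -
  obtain \<phi> where "free_vars \<phi> \<subseteq> {..<k}" "\<forall>e. sat e \<phi> \<longleftrightarrow> P e"
    using assms by (auto simp: pdef_def)
  then show ?thesis unfolding pdef_def by (intro exI[of _ "Neg \<phi>"]) auto
qed

lemma pdef_less: "plin k F \<Longrightarrow> plin k G \<Longrightarrow> pdef k (\<lambda>e. F e < G e)"
  using pdef_not[OF pdef_le] by (simp add: not_le)

lemma pdef_conj:
  assumes "pdef k P" "pdef k Q"
  shows "pdef k (\<lambda>e. P e \<and> Q e)"
proof -
  obtain \<phi> \<psi> where "free_vars \<phi> \<subseteq> {..<k}" "\<forall>e. sat e \<phi> \<longleftrightarrow> P e"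
    "free_vars \<psi> \<subseteq> {..<k}" "\<forall>e. sat e \<psi> \<longleftrightarrow> Q e"
    using assms by (auto simp: pdef_def)
  then show ?thesis unfolding pdef_def by (intro exI[of _ "And \<phi> \<psi>"]) auto
qed

lemma pdef_disj: "pdef k P \<Longrightarrow> pdef k Q \<Longrightarrow> pdef k (\<lambda>e. P e \<or> Q e)"
  using pdef_not[OF pdef_conj[OF pdef_not pdef_not]] by simp

lemma pdef_bex:
  assumes "finite S" "\<And>s. s \<in> S \<Longrightarrow> pdef k (P s)"
  shows "pdef k (\<lambda>e. \<exists>s\<in>S. P s e)"
  using assms
proof (induction S rule: finite_induct)
  case empty
  show ?case using pdef_eq[OF plin_zero plin_one] by simp
next
  case (insert s S)
  then show ?case using pdef_disj[of k "P s" "\<lambda>e. \<exists>s\<in>S. P s e"] by simp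
qed

lemma pdef_all_less:
  assumes "\<And>j. j < (m :: nat) \<Longrightarrow> pdef k (P j)"
  shows "pdef k (\<lambda>e. \<forall>j<m. P j e)"
proof -
  have "pdef k (\<lambda>e. \<not> (\<exists>j\<in>{..<m}. \<not> P j e))"
    by (intro pdef_not pdef_bex assms) auto
  then show ?thesis by (simp add: Ball_def)
qed

lemma pdef_meets:
  assumes "plin k F"
  shows "pdef k (\<lambda>e. meets (F e) b)"
proof (cases b)
  case (Exactly d)
  then show ?thesis using pdef_eq[OF assms plin_const] by simp
next
  case (AtLeast d)
  then show ?thesis using pdef_le[OF plin_const assms] by simp
qed

section \<open>Dependence on free variables and blocks of existential quantifiers\<close>

lemma eval_pterm_cong: "(\<And>v. v \<in> vars_pterm t \<Longrightarrow> e v = e' v) \<Longrightarrow> eval_pterm e t = eval_pterm e' t"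
  by (induction t) auto

lemma sat_cong: "(\<And>v. v \<in> free_vars \<phi> \<Longrightarrow> e v = e' v) \<Longrightarrow> sat e \<phi> \<longleftrightarrow> sat e' \<phi>"
proof (induction \<phi> arbitrary: e e')
  case (Eq s t)
  then show ?case using eval_pterm_cong[of s e e'] eval_pterm_cong[of t e e'] by simp
next
  case (Le s t)
  then show ?case using eval_pterm_cong[of s e e'] eval_pterm_cong[of t e e'] by simp
next
  case (Neg \<phi>)
  show ?case using Neg.IH[of e e'] Neg.prems by simp
next
  case (And \<phi> \<psi>)
  show ?case using And.IH(1)[of e e'] And.IH(2)[of e e'] And.prems by simp
next
  case (Or \<phi> \<psi>)
  show ?case using Or.IH(1)[of e e'] Or.IH(2)[of e e'] Or.prems by simp
next
  case (Exists x \<phi>)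
  have "sat (e(x := a)) \<phi> \<longleftrightarrow> sat (e'(x := a)) \<phi>" for a
    using Exists.prems by (intro Exists.IH) auto
  then show ?case by simp
next
  case (Forall x \<phi>)
  have "sat (e(x := a)) \<phi> \<longleftrightarrow> sat (e'(x := a)) \<phi>" for a
    using Forall.prems by (intro Forall.IH) auto
  then show ?case by simp
qed

text \<open>Quantifies the variables from \<open>k\<close> to \<open>k + r - 1\<close>, the last one
  innermost. The assignment \<open>e'\<close> may also differ beyond them, which is harmless because
  a definable \<open>P\<close> depends only on its first \<open>k + r\<close> variables.\<close>

lemma pdef_exists: "pdef (k + r) P \<Longrightarrow> pdef k (\<lambda>e. \<exists>e'. (\<forall>v<k. e' v = e v) \<and> P e')"
proof (induction r arbitrary: P)
  case 0
  then obtain \<phi> where \<phi>: "free_vars \<phi> \<subseteq> {..<k}" "\<forall>e. sat e \<phi> \<longleftrightarrow> P e"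
    by (auto simp: pdef_def)
  have "(\<exists>e'. (\<forall>v<k. e' v = e v) \<and> P e') \<longleftrightarrow> P e" for e
  proof
    assume "\<exists>e'. (\<forall>v<k. e' v = e v) \<and> P e'"
    then obtain e' where "\<forall>v<k. e' v = e v" "P e'" by blast
    then show "P e" using sat_cong[of \<phi> e' e] \<phi> by auto
  qed auto
  then show ?case using 0 by simp
next
  case (Suc r)
  then obtain \<phi> where \<phi>: "free_vars \<phi> \<subseteq> {..<k + Suc r}" "\<forall>e. sat e \<phi> \<longleftrightarrow> P e"
    by (auto simp: pdef_def)
  have "pdef (k + r) (\<lambda>e. \<exists>a. P (e(k + r := a)))"
    unfolding pdef_def using \<phi> by (intro exI[of _ "Exists (k + r) \<phi>"]) (auto simp: less_Suc_eq)
  note IH = Suc.IH[OF this]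
  have eq: "(\<exists>e'. (\<forall>v<k. e' v = e v) \<and> (\<exists>a. P (e'(k + r := a)))) \<longleftrightarrow>
    (\<exists>e'. (\<forall>v<k. e' v = e v) \<and> P e')" for e
  proof
    assume "\<exists>e'. (\<forall>v<k. e' v = e v) \<and> (\<exists>a. P (e'(k + r := a)))"
    then obtain e' a where "\<forall>v<k. e' v = e v" "P (e'(k + r := a))" by blast
    then show "\<exists>e'. (\<forall>v<k. e' v = e v) \<and> P e'"
      by (intro exI[of _ "e'(k + r := a)"]) auto
  next
    assume "\<exists>e'. (\<forall>v<k. e' v = e v) \<and> P e'"
    then obtain e' where "\<forall>v<k. e' v = e v" "P e'" by blast
    then show "\<exists>e'. (\<forall>v<k. e' v = e v) \<and> (\<exists>a. P (e'(k + r := a)))"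
      by (intro exI[of _ e'] conjI exI[of _ "e' (k + r)"]) auto
  qed
  show ?case using IH unfolding eq .
qed

section \<open>Definability of the counting conditions\<close>

lemma pdef_side:
  assumes "\<And>j. j < m \<Longrightarrow> plin k (\<lambda>e. X e j)" "finite S"
    and "\<And>t. t \<in> types l m q C \<Longrightarrow> plin k (\<lambda>e. x e t)" "\<And>s. s \<in> S \<Longrightarrow> plin k (\<lambda>e. y e s)"
  shows "pdef k (\<lambda>e. side l m p c q C g S (x e) (y e) (X e))"
  unfolding side_def
  by (intro pdef_conj pdef_all_less pdef_eq pdef_meets plin_add plin_const plin_sum plin_mult_const
      finite_types assms)

lemma pdef_counts:
  assumes "\<And>j. j < m \<Longrightarrow> plin k (\<lambda>e. X e j)" "\<And>j. j < n \<Longrightarrow> plin k (\<lambda>e. Y e j)"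
    and "\<And>t. t \<in> types l m q C \<Longrightarrow> plin k (\<lambda>e. x e t)"
    and "\<And>s. s \<in> types l n p D \<Longrightarrow> plin k (\<lambda>e. y e s)"
  shows "pdef k (\<lambda>e. counts l m n C D T p c q d g (X e) (Y e) (x e) (y e))"
proof -
  have "plin k (\<lambda>e. residual l m q C (x e) i)" "plin k (\<lambda>e. residual l n p D (y e) i)" for i
    unfolding residual_def by (intro plin_sum plin_mult_const finite_types assms; assumption)+
  then show ?thesis
    unfolding counts_def
    by (intro pdef_conj pdef_side pdef_all_less pdef_disj pdef_eq pdef_less plin_const
        finite_types assms)
qed

lemma counts_cong:
  assumes "\<And>j. j < m \<Longrightarrow> X j = X' j" "\<And>j. j < n \<Longrightarrow> Y j = Y' j"
    and "\<And>t. t \<in> types l m q C \<Longrightarrow> x t = x' t" "\<And>s. s \<in> types l n p D \<Longrightarrow> y s = y' s"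
  shows "counts l m n C D T p c q d g X Y x y \<longleftrightarrow> counts l m n C D T p c q d g X' Y' x' y'"
  using assms by (simp add: counts_def side_def residual_def cong: sum.cong)

text \<open>Only the values of \<open>x\<close> and \<open>y\<close> on the finitely many types
  matter, so each type gets one quantified variable, numbered by \<open>h\<close> and
  \<open>h'\<close> after the \<open>m + n\<close> free ones.\<close>

lemma pdef_ex_counts:
  "pdef (m + n) (\<lambda>e. \<exists>x y. counts l m n C D T p c q d g e (\<lambda>j. e (m + j)) x y)"
proof -
  let ?A = "types l m q C" and ?A' = "types l n p D"
  let ?k = "m + n + (card ?A + card ?A')"
  obtain h0 where h0: "bij_betw h0 ?A {0..<card ?A}" using ex_bij_betw_finite_nat[OF finite_types] by blast
  obtain h0' where h0': "bij_betw h0' ?A' {0..<card ?A'}" using ex_bij_betw_finite_nat[OF finite_types] by blast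
  define h where "h t = m + n + h0 t" for t
  define h' where "h' t = m + n + card ?A + h0' t" for t
  have h: "m + n \<le> h t" "h t < m + n + card ?A" if "t \<in> ?A" for t
    using that bij_betwE[OF h0] by (auto simp: h_def)
  have h': "m + n + card ?A \<le> h' t" "h' t < ?k" if "t \<in> ?A'" for t
    using that bij_betwE[OF h0'] by (auto simp: h'_def)
  let ?P = "\<lambda>e. counts l m n C D T p c q d g e (\<lambda>j. e (m + j)) (\<lambda>t. e (h t)) (\<lambda>t. e (h' t))"
  have "pdef ?k ?P"
    by (intro pdef_counts plin_var) (use h h' in \<open>force+\<close>)
  then have "pdef (m + n) (\<lambda>e. \<exists>e'. (\<forall>v<m + n. e' v = e v) \<and> ?P e')"
    by (rule pdef_exists)
  moreover have "(\<exists>e'. (\<forall>v<m + n. e' v = e v) \<and> ?P e') \<longleftrightarrow>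
    (\<exists>x y. counts l m n C D T p c q d g e (\<lambda>j. e (m + j)) x y)" (is "?L \<longleftrightarrow> ?R") for e
  proof
    assume ?L
    then obtain e' where e': "\<forall>v<m + n. e' v = e v" "?P e'" by blast
    then have "counts l m n C D T p c q d g e (\<lambda>j. e (m + j)) (\<lambda>t. e' (h t)) (\<lambda>t. e' (h' t))"
      by (subst counts_cong[where X' = e' and Y' = "\<lambda>j. e' (m + j)"]) auto
    then show ?R by blast
  next
    assume ?R
    then obtain x y where xy: "counts l m n C D T p c q d g e (\<lambda>j. e (m + j)) x y" by blast
    \<comment> \<open>The inverse numberings place the values of \<open>x\<close> and
      \<open>y\<close> at the variables of their types.\<close>
    define e' where "e' v = (if v < m + n then e v else if v < m + n + card ?A
      then x (inv_into ?A h0 (v - (m + n))) else y (inv_into ?A' h0' (v - (m + n + card ?A))))" for v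
    have "e' (h t) = x t" if "t \<in> ?A" for t
      using h[OF that] that bij_betw_inv_into_left[OF h0 that] by (simp add: e'_def h_def)
    moreover have "e' (h' t) = y t" if "t \<in> ?A'" for t
      using h'[OF that] that bij_betw_inv_into_left[OF h0' that] by (simp add: e'_def h'_def)
    moreover have e: "e' v = e v" if "v < m + n" for v using that by (simp add: e'_def)
    ultimately have "?P e'" using xy
      by (subst counts_cong[where X' = e and Y' = "\<lambda>j. e (m + j)" and x' = x and y' = y]) auto
    then show ?L using e by blast
  qed
  ultimately show ?thesis by simp
qed

theorem theorem9:
  fixes C D :: "bnum mat" and l m n :: nat
  assumes "C \<in> carrier_mat l m" and "D \<in> carrier_mat l n"
  shows "\<exists>\<phi>. free_vars \<phi> \<subseteq> {..<m + n} \<and>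
    (\<forall>M \<in> carrier_vec m. \<forall>N \<in> carrier_vec n. big_enough C D M N \<longrightarrow>
      ((\<exists>(U :: nat set) (V :: nat set) E. biregular C D M N U V E) \<longleftrightarrow>
       sat (assignment M N) \<phi>))"
proof -
  \<comment> \<open>The sum of all entries of both matrices serves as a common bound for each
    entry.\<close>
  define B where "B = (\<Sum>i<l. \<Sum>j<m. bfloor (C $$ (i, j))) + (\<Sum>i<l. \<Sum>j<n. bfloor (D $$ (i, j)))"
  have entry_le: "bfloor (A $$ (i, j)) \<le> (\<Sum>i<l. \<Sum>j<k. bfloor (A $$ (i, j)))"
    if "i < l" "j < k" for A i j k
  proof -
    have "bfloor (A $$ (i, j)) \<le> (\<Sum>j<k. bfloor (A $$ (i, j)))"
      using that by (intro member_le_sum) auto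
    also have "\<dots> \<le> (\<Sum>i<l. \<Sum>j<k. bfloor (A $$ (i, j)))"
      using that by (intro member_le_sum[of i "{..<l}" "\<lambda>i. \<Sum>j<k. bfloor (A $$ (i, j))"]) auto
    finally show ?thesis .
  qed
  have CB: "bfloor (C $$ (i, j)) \<le> B" if "i < l" "j < m" for i j
    using entry_le[OF that, of C] by (simp add: B_def)
  have DB: "bfloor (D $$ (i, j)) \<le> B" if "i < l" "j < n" for i j
    using entry_le[OF that, of D] by (simp add: B_def)
  define T where "T = 3 * l * B * B"
  define K where "K = l * (2 * l * B * B + 2 * l * B + 1) + l * T"
  \<comment> \<open>The choices of the exceptional vertices, their columns and mutual colours form a
    finite disjunction; only the multiplicities \<open>x\<close> and \<open>y\<close> are
    quantified.\<close>
  let ?P = "\<lambda>e. \<exists>p\<in>{..K}. \<exists>q\<in>{..K}. \<exists>c\<in>{..<p} \<rightarrow>\<^sub>E {..<m}. \<exists>d\<in>{..<q} \<rightarrow>\<^sub>E {..<n}.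
    \<exists>g\<in>{..<p} \<rightarrow>\<^sub>E {..<q} \<rightarrow>\<^sub>E {..l}. \<exists>x y. counts l m n C D T p c q d g e (\<lambda>j. e (m + j)) x y"
  have "pdef (m + n) ?P"
    by (intro pdef_bex pdef_ex_counts finite_PiE) auto
  then obtain \<phi> where \<phi>: "free_vars \<phi> \<subseteq> {..<m + n}" "\<And>e. sat e \<phi> \<longleftrightarrow> ?P e"
    by (auto simp: pdef_def)
  have main: "(\<exists>(U :: nat set) (V :: nat set) E. biregular C D M N U V E) \<longleftrightarrow> ?P (assignment M N)"
    if M: "M \<in> carrier_vec m" and N: "N \<in> carrier_vec n" for M N
  proof -
    \<comment> \<open>\<open>counts\<close> reads the sizes only at indices below \<open>m\<close>
      and \<open>n\<close>, where the assignment agrees with the vectors.\<close>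
    have asg: "counts l m n C D T p c q d g (assignment M N) (\<lambda>j. assignment M N (m + j)) x y \<longleftrightarrow>
      counts l m n C D T p c q d g (($) M) (($) N) x y" for p c q d g x y
      using M N by (intro counts_cong) (auto simp: assignment_def)
    show ?thesis unfolding asg
    proof
      assume "\<exists>(U :: nat set) (V :: nat set) E. biregular C D M N U V E"
      then obtain U V :: "nat set" and c d f where "coloured l m n C D (($) M) (($) N) U V c d f"
        using biregular_imp_coloured[OF assms(1) M N] by blast
      from counts_complete[OF this CB DB K_def]
      show "\<exists>p\<in>{..K}. \<exists>q\<in>{..K}. \<exists>c\<in>{..<p} \<rightarrow>\<^sub>E {..<m}. \<exists>d\<in>{..<q} \<rightarrow>\<^sub>E {..<n}.
        \<exists>g\<in>{..<p} \<rightarrow>\<^sub>E {..<q} \<rightarrow>\<^sub>E {..l}. \<exists>x y. counts l m n C D T p c q d g (($) M) (($) N) x y"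
        by (simp add: Bex_def)
    next
      assume "\<exists>p\<in>{..K}. \<exists>q\<in>{..K}. \<exists>c\<in>{..<p} \<rightarrow>\<^sub>E {..<m}. \<exists>d\<in>{..<q} \<rightarrow>\<^sub>E {..<n}.
        \<exists>g\<in>{..<p} \<rightarrow>\<^sub>E {..<q} \<rightarrow>\<^sub>E {..l}. \<exists>x y. counts l m n C D T p c q d g (($) M) (($) N) x y"
      then obtain p q c d g x y where *: "c \<in> {..<p} \<rightarrow>\<^sub>E {..<m}" "d \<in> {..<q} \<rightarrow>\<^sub>E {..<n}"
        "counts l m n C D T p c q d g (($) M) (($) N) x y" by blast
      have "\<forall>a<p. c a < m" "\<forall>b<q. d b < n" using *(1,2) by (auto simp: PiE_iff)
      from counts_sound[OF *(3) this CB DB T_def]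
      show "\<exists>(U :: nat set) (V :: nat set) E. biregular C D M N U V E"
        using coloured_imp_biregular[OF assms(1) M N] by blast
    qed
  qed
  show ?thesis
  proof (intro exI conjI ballI impI)
    show "free_vars \<phi> \<subseteq> {..<m + n}" by (rule \<phi>(1))
    fix M N :: "nat vec"
    assume "M \<in> carrier_vec m" "N \<in> carrier_vec n"
    then show "(\<exists>(U :: nat set) (V :: nat set) E. biregular C D M N U V E) \<longleftrightarrow> sat (assignment M N) \<phi>"
      unfolding \<phi>(2) by (rule main)
  qed
qed

end
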